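(* Let $\mathbf K$ be a stable AEC. (2) Let $\kappa$ be an infinite cardinal. If $\mathbf K$ is $(<\kappa)$-tame and does not have the $(<\kappa)$-order property of length $\chi:=2^{<(\kappa+\operatorname{LS}(\mathbf K)^+)}$, then the first stability cardinal of $\mathbf K$ is bounded above by $2^{2^{<\chi}}$. (3) If $\mathbf K$ is $\operatorname{LS}(\mathbf K)$-tame and does not have the $\operatorname{LS}(\mathbf K)$-order property of length $2^{\operatorname{LS}(\mathbf K)}$, then the first stability cardinal of $\mathbf K$ is bounded above by $\beth_3(\operatorname{LS}(\mathbf K))$. (4) Let $|D(T)|:=|\operatorname{gS}^{<\omega}(\emptyset)|$. If $\mathbf K$ is $(<\aleph_0)$-tame and does not have the $(<\omega)$-order property of length $|D(T)|$, then the first stability cardinal of $\mathbf K$ is bounded above by $\beth_2(|D(T)|)$.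
   Context: $\mathbf K=\langle K,\le_{\mathbf K}\rangle$ denotes an abstract elementary class (AEC) and $|M|$ the universe of $M\in K$. For a sequence $a$ of elements of $M\in K$ and $A\subseteq |M|$, $\operatorname{gtp}(a/A,M)$ is the Galois (orbital) type: the class of $(a,A,M)$ under the transitive closure of the relation identifying $(a,A,M)$ with $(b,A,N)$ when there are $L\in K$ and $\mathbf K$-embeddings $f:M\to L$, $g:N\to L$ agreeing with the identity on $A$ with $f(a)=g(b)$. $\operatorname{gS}^{\beta}(A;M)$ is the set of Galois types over $A$ of sequences of length $\beta$ from $M$; $\operatorname{gS}^{<\alpha}(A;M)$ is the union over $\beta<\alpha$; $\operatorname{gS}^{<\alpha}(A)$ is the union of $\operatorname{gS}^{<\alpha}(A;M)$ over all $M\in K$ with $|M|\supseteq A$. Stability: $\mathbf K$ is stable in an infinite cardinal $\mu$ if for every $M\in K$ and $A\subseteq|M|$ with $|A|\le\mu$, $|\operatorname{gS}^{<2}(A;M)|\le\mu$; $\mathbf K$ is stable if it is stable in some $\mu\ge\operatorname{LS}(\mathbf K)$. The first stability cardinal is the least $\mu\ge\operatorname{LS}(\mathbf K)$ in which $\mathbf K$ is stable; in item (4), infinite cardinals $\mu$ below $\operatorname{LS}(\mathbf K)$ are also allowed. Order property: for an infinite cardinal $\mu$ and an ordinal $\beta\ge1$, $\mathbf K$ has the $\beta$-order property of length $\mu$ if there are $M\in K$ and sequences $\langle a_i:i<\mu\rangle$ from $M$, each of length $\beta$, such that for all $i_0<i_1<\mu$ and $j_0<j_1<\mu$, $\operatorname{gtp}(a_{i_0}a_{i_1}/\emptyset,M)\ne\operatorname{gtp}(a_{j_1}a_{j_0}/\emptyset,M)$.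 $\mathbf K$ has the $(<\alpha)$-order property of length $\mu$ if it has the $\beta$-order property of length $\mu$ for some $\beta<\alpha$. (In (3), "$\operatorname{LS}(\mathbf K)$-order property" is the $\beta$-order property with $\beta=\operatorname{LS}(\mathbf K)$.) Tameness: $\mathbf K$ is $(<\kappa)$-tame if for every subset $A$ of some model of $K$ and all $p\ne q\in\operatorname{gS}^{<2}(A)$ there is $A_0\subseteq A$ with $|A_0|<\kappa$ and $p\restriction A_0\ne q\restriction A_0$; $\mu$-tame means $(<\mu^+)$-tame. $\beth_0(\mu)=\mu$, $\beth_{n+1}(\mu)=2^{\beth_n(\mu)}$; $2^{<\chi}=\sup\{2^{\nu}:\nu<\chi\text{ a cardinal}\}$. *)

theory Defs
  imports Main
begin

unbundle cardinal_syntax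

section \<open>Cardinals\<close>

text \<open>
  Cardinals are cardinal orders as in Main (\<open>Card_order\<close>), compared by \<open>\<le>o\<close> and \<open>=o\<close>; ordinals are
  well-orders.  \<open>least_card P\<close> is the least cardinal satisfying \<open>P\<close>; it is determined only up to
  \<open>=o\<close>, and \<open>P\<close> is always invariant under \<open>=o\<close> below.  It is meaningful when some cardinal
  satisfies \<open>P\<close>.
\<close>

definition least_card :: "('a rel \<Rightarrow> bool) \<Rightarrow> 'a rel" where
  "least_card P = (SOME \<mu>. Card_order \<mu> \<and> P \<mu> \<and> (\<forall>\<nu>. Card_order \<nu> \<and> P \<nu> \<longrightarrow> \<mu> \<le>o \<nu>))"

abbreviation exp2 :: "'a rel \<Rightarrow> ('a \<Rightarrow> bool) rel" where
  "exp2 \<mu> \<equiv> ctwo ^c \<mu>"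

abbreviation beth2 :: "'a rel \<Rightarrow> (('a \<Rightarrow> bool) \<Rightarrow> bool) rel" where
  "beth2 \<mu> \<equiv> exp2 (exp2 \<mu>)"

abbreviation beth3 :: "'a rel \<Rightarrow> ((('a \<Rightarrow> bool) \<Rightarrow> bool) \<Rightarrow> bool) rel" where
  "beth3 \<mu> \<equiv> exp2 (beth2 \<mu>)"

text \<open>
  The supremum of the cardinals \<open>2\<^sup>\<nu>\<close> for \<open>\<nu> < \<theta>\<close>.  Every cardinal below \<open>\<theta> :: 'a rel\<close> has a
  representative of type \<open>'a rel\<close>, and the supremum is at most \<open>2\<close> to the power \<open>\<theta>\<close>, so it has a
  representative of type \<open>'a set rel\<close>.
\<close>

definition exp2_less :: "'a rel \<Rightarrow> 'a set rel" where
  "exp2_less \<theta> =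
     least_card (\<lambda>\<chi>. \<forall>\<nu> :: 'a rel. Card_order \<nu> \<and> \<nu> <o \<theta> \<longrightarrow> exp2 \<nu> \<le>o \<chi>)"

definition strongly_inaccessible :: "'a rel \<Rightarrow> bool" where
  "strongly_inaccessible \<theta> \<longleftrightarrow> Card_order \<theta> \<and> natLeq <o \<theta> \<and> regularCard \<theta> \<and>
     (\<forall>\<nu> :: 'a rel. Card_order \<nu> \<and> \<nu> <o \<theta> \<longrightarrow> exp2 \<nu> <o \<theta>)"

text \<open>
  An abstract elementary class is a proper class.  HOL has no proper classes, so the universe of
  sets is replaced by a type \<open>'u\<close> whose cardinality is strongly inaccessible (a Grothendieck
  universe): the elements of structures are taken from \<open>'u\<close>, structures, vocabularies and cardinals
  are \<^emph>\<open>small\<close>, i.e. of cardinality below that of \<open>'u\<close>, and a class of structures is an arbitrary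
  set of small structures.
\<close>

definition small :: "'u rel \<Rightarrow> bool" where
  "small \<mu> \<longleftrightarrow> \<mu> <o |UNIV :: 'u set|"

text \<open>
  The ordinals below the well-order \<open>\<alpha>\<close>, one representative each, namely the proper initial
  segments of \<open>\<alpha>\<close>.
\<close>

definition ordinals_below :: "'i rel \<Rightarrow> 'i rel set" where
  "ordinals_below \<alpha> = {Restr \<alpha> (underS \<alpha> b) | b. b \<in> Field \<alpha>}"

definition limit_ordinal :: "'i rel \<Rightarrow> bool" where
  "limit_ordinal \<delta> \<longleftrightarrow> Well_order \<delta> \<and> Field \<delta> \<noteq> {} \<and>
     (\<forall>i \<in> Field \<delta>. \<exists>j \<in> Field \<delta>. (i, j) \<in> \<delta> \<and> i \<noteq> j)"

section \<open>Structures\<close>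

record ('f, 'r) vocabulary =
  fun_syms :: "'f set"
  rel_syms :: "'r set"
  fun_ar :: "'f \<Rightarrow> nat"
  rel_ar :: "'r \<Rightarrow> nat"

record ('u, 'f, 'r) fo_struct =
  carrier :: "'u set"
  fun_in :: "'f \<Rightarrow> 'u list \<Rightarrow> 'u"
  rel_in :: "'r \<Rightarrow> 'u list set"

definition tuples :: "'u set \<Rightarrow> nat \<Rightarrow> 'u list set" where
  "tuples A n = {xs. set xs \<subseteq> A \<and> length xs = n}"

text \<open>
  Interpretations are trivial outside the vocabulary and outside the universe of the structure, so
  that a structure is determined by its universe and its interpretations of the symbols.
\<close>

definition is_struct :: "('f, 'r) vocabulary \<Rightarrow> ('u, 'f, 'r) fo_struct \<Rightarrow> bool" where
  "is_struct \<tau> M \<longleftrightarrow> carrier M \<noteq> {} \<and> small |carrier M| \<and>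
     (\<forall>F \<in> fun_syms \<tau>. \<forall>xs \<in> tuples (carrier M) (fun_ar \<tau> F). fun_in M F xs \<in> carrier M) \<and>
     (\<forall>F xs. \<not> (F \<in> fun_syms \<tau> \<and> xs \<in> tuples (carrier M) (fun_ar \<tau> F)) \<longrightarrow>
        fun_in M F xs = undefined) \<and>
     (\<forall>R \<in> rel_syms \<tau>. rel_in M R \<subseteq> tuples (carrier M) (rel_ar \<tau> R)) \<and>
     (\<forall>R. R \<notin> rel_syms \<tau> \<longrightarrow> rel_in M R = {})"

definition substruct ::
  "('f, 'r) vocabulary \<Rightarrow> ('u, 'f, 'r) fo_struct \<Rightarrow> ('u, 'f, 'r) fo_struct \<Rightarrow> bool" where
  "substruct \<tau> M N \<longleftrightarrow> carrier M \<subseteq> carrier N \<and>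
     (\<forall>F \<in> fun_syms \<tau>. \<forall>xs \<in> tuples (carrier M) (fun_ar \<tau> F). fun_in M F xs = fun_in N F xs) \<and>
     (\<forall>R \<in> rel_syms \<tau>. \<forall>xs \<in> tuples (carrier M) (rel_ar \<tau> R).
        xs \<in> rel_in M R \<longleftrightarrow> xs \<in> rel_in N R)"

definition is_iso ::
  "('f, 'r) vocabulary \<Rightarrow> ('u \<Rightarrow> 'u) \<Rightarrow> ('u, 'f, 'r) fo_struct \<Rightarrow> ('u, 'f, 'r) fo_struct \<Rightarrow> bool" where
  "is_iso \<tau> f M N \<longleftrightarrow> bij_betw f (carrier M) (carrier N) \<and>
     (\<forall>F \<in> fun_syms \<tau>. \<forall>xs \<in> tuples (carrier M) (fun_ar \<tau> F).
        f (fun_in M F xs) = fun_in N F (map f xs)) \<and>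
     (\<forall>R \<in> rel_syms \<tau>. \<forall>xs \<in> tuples (carrier M) (rel_ar \<tau> R).
        xs \<in> rel_in M R \<longleftrightarrow> map f xs \<in> rel_in N R)"

text \<open>
  \<open>M\<close> is the union of the increasing chain \<open>Ms\<close> of structures: its universe is the union of the
  universes, and its interpretations extend those of all members of the chain.
\<close>

definition is_chain_union ::
  "('f, 'r) vocabulary \<Rightarrow> 'i set \<Rightarrow> ('i \<Rightarrow> ('u, 'f, 'r) fo_struct) \<Rightarrow> ('u, 'f, 'r) fo_struct \<Rightarrow> bool" where
  "is_chain_union \<tau> I Ms M \<longleftrightarrow> is_struct \<tau> M \<and> carrier M = (\<Union>i \<in> I. carrier (Ms i)) \<and>
     (\<forall>i \<in> I. substruct \<tau> (Ms i) M)"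

section \<open>Abstract elementary classes\<close>

record ('u, 'f, 'r) abstract_class =
  vocab :: "('f, 'r) vocabulary"
  models :: "('u, 'f, 'r) fo_struct set"
  strong :: "('u, 'f, 'r) fo_struct \<Rightarrow> ('u, 'f, 'r) fo_struct \<Rightarrow> bool"

text \<open>
  \<open>LS K\<close> is the least cardinal \<open>\<theta> \<ge> \<bar>\<tau>\<bar> + \<aleph>\<^sub>0\<close> witnessing the Loewenheim-Skolem-Tarski axiom.
\<close>

definition is_LS_bound :: "('u, 'f, 'r) abstract_class \<Rightarrow> 'u rel \<Rightarrow> bool" where
  "is_LS_bound K \<theta> \<longleftrightarrow> small \<theta> \<and> natLeq \<le>o \<theta> \<and>
     |fun_syms (vocab K) <+> rel_syms (vocab K)| \<le>o \<theta> \<and>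
     (\<forall>M \<in> models K. \<forall>A \<subseteq> carrier M. \<exists>M0 \<in> models K.
        strong K M0 M \<and> A \<subseteq> carrier M0 \<and> |carrier M0| \<le>o |A| +c \<theta>)"

definition LS :: "('u, 'f, 'r) abstract_class \<Rightarrow> 'u rel" where
  "LS K = least_card (is_LS_bound K)"

text \<open>
  As usual in model theory, structures are nonempty, vocabularies are finitary and the class itself
  is nonempty.
\<close>

locale AEC =
  fixes K :: "('u, 'f, 'r) abstract_class"
  assumes nonempty: "models K \<noteq> {}"
    and models_struct: "M \<in> models K \<Longrightarrow> is_struct (vocab K) M"
    and strong_models: "strong K M N \<Longrightarrow> M \<in> models K \<and> N \<in> models K"
    and strong_refl: "M \<in> models K \<Longrightarrow> strong K M M"
    and strong_antisym: "strong K M N \<Longrightarrow> strong K N M \<Longrightarrow> M = N"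
    and strong_trans: "strong K M N \<Longrightarrow> strong K N P \<Longrightarrow> strong K M P"
    and strong_substruct: "strong K M N \<Longrightarrow> substruct (vocab K) M N"
    and iso_models:
      "M \<in> models K \<Longrightarrow> is_struct (vocab K) N \<Longrightarrow> is_iso (vocab K) f M N \<Longrightarrow> N \<in> models K"
    and iso_strong:
      "strong K M N \<Longrightarrow> is_struct (vocab K) M' \<Longrightarrow> is_struct (vocab K) N' \<Longrightarrow>
       substruct (vocab K) M' N' \<Longrightarrow> is_iso (vocab K) f N N' \<Longrightarrow> is_iso (vocab K) f M M' \<Longrightarrow>
       strong K M' N'"
    and coherence:
      "strong K M0 M2 \<Longrightarrow> strong K M1 M2 \<Longrightarrow> substruct (vocab K) M0 M1 \<Longrightarrow> strong K M0 M1"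
    and chain_union:
      "limit_ordinal (\<delta> :: 'u rel) \<Longrightarrow> small \<delta> \<Longrightarrow>
       (\<And>i. i \<in> Field \<delta> \<Longrightarrow> Ms i \<in> models K) \<Longrightarrow>
       (\<And>i j. (i, j) \<in> \<delta> \<Longrightarrow> strong K (Ms i) (Ms j)) \<Longrightarrow>
       is_chain_union (vocab K) (Field \<delta>) Ms M \<Longrightarrow>
       M \<in> models K \<and> (\<forall>i \<in> Field \<delta>. strong K (Ms i) M)"
    and smoothness:
      "limit_ordinal (\<delta> :: 'u rel) \<Longrightarrow> small \<delta> \<Longrightarrow>
       (\<And>i. i \<in> Field \<delta> \<Longrightarrow> Ms i \<in> models K) \<Longrightarrow>
       (\<And>i j. (i, j) \<in> \<delta> \<Longrightarrow> strong K (Ms i) (Ms j)) \<Longrightarrow>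
       is_chain_union (vocab K) (Field \<delta>) Ms M \<Longrightarrow>
       (\<And>i. i \<in> Field \<delta> \<Longrightarrow> strong K (Ms i) N) \<Longrightarrow> strong K M N"
    and LS_axiom: "\<exists>\<theta> :: 'u rel. Card_order \<theta> \<and> is_LS_bound K \<theta>"

definition K_embedding ::
  "('u, 'f, 'r) abstract_class \<Rightarrow> ('u \<Rightarrow> 'u) \<Rightarrow> ('u, 'f, 'r) fo_struct \<Rightarrow> ('u, 'f, 'r) fo_struct \<Rightarrow> bool"
  where
  "K_embedding K f M N \<longleftrightarrow> (\<exists>N0 \<in> models K. is_iso (vocab K) f M N0 \<and> strong K N0 N)"

section \<open>Galois types\<close>

text \<open>
  A sequence of length \<open>\<beta>\<close> (a well-order) is a partial function with domain \<open>Field \<beta>\<close>.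
\<close>

type_synonym ('i, 'u, 'f, 'r) triple = "('i \<rightharpoonup> 'u) \<times> 'u set \<times> ('u, 'f, 'r) fo_struct"

definition gal_step ::
  "('u, 'f, 'r) abstract_class \<Rightarrow> ('i, 'u, 'f, 'r) triple rel" where
  "gal_step K = {((a, A, M), (b, A, N)) | a b A M N.
     M \<in> models K \<and> N \<in> models K \<and> A \<subseteq> carrier M \<and> A \<subseteq> carrier N \<and>
     ran a \<subseteq> carrier M \<and> ran b \<subseteq> carrier N \<and>
     (\<exists>L \<in> models K. \<exists>f g. K_embedding K f M L \<and> K_embedding K g N L \<and>
        (\<forall>x \<in> A. f x = x \<and> g x = x) \<and> map_option f \<circ> a = map_option g \<circ> b)}"

definition gtp ::
  "('u, 'f, 'r) abstract_class \<Rightarrow> ('i \<rightharpoonup> 'u) \<Rightarrow> 'u set \<Rightarrow> ('u, 'f, 'r) fo_struct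
   \<Rightarrow> ('i, 'u, 'f, 'r) triple set" where
  "gtp K a A M = (gal_step K)\<^sup>+ `` {(a, A, M)}"

definition gtp_restrict ::
  "('u, 'f, 'r) abstract_class \<Rightarrow> ('i, 'u, 'f, 'r) triple set \<Rightarrow> 'u set
   \<Rightarrow> ('i, 'u, 'f, 'r) triple set" where
  "gtp_restrict K p A0 = (\<Union>(a, A, M) \<in> p. gtp K a A0 M)"

definition gS_in ::
  "('u, 'f, 'r) abstract_class \<Rightarrow> 'i rel \<Rightarrow> 'u set \<Rightarrow> ('u, 'f, 'r) fo_struct
   \<Rightarrow> ('i, 'u, 'f, 'r) triple set set" where
  "gS_in K \<beta> A M = {gtp K a A M | a. dom a = Field \<beta> \<and> ran a \<subseteq> carrier M}"

definition gS_less_in ::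
  "('u, 'f, 'r) abstract_class \<Rightarrow> 'i rel \<Rightarrow> 'u set \<Rightarrow> ('u, 'f, 'r) fo_struct
   \<Rightarrow> ('i, 'u, 'f, 'r) triple set set" where
  "gS_less_in K \<alpha> A M = (\<Union>\<beta> \<in> ordinals_below \<alpha>. gS_in K \<beta> A M)"

definition gS_less ::
  "('u, 'f, 'r) abstract_class \<Rightarrow> 'i rel \<Rightarrow> 'u set \<Rightarrow> ('i, 'u, 'f, 'r) triple set set" where
  "gS_less K \<alpha> A = (\<Union>M \<in> {M \<in> models K. A \<subseteq> carrier M}. gS_less_in K \<alpha> A M)"

definition card_D :: "('u, 'f, 'r) abstract_class \<Rightarrow> (nat, 'u, 'f, 'r) triple set rel" where
  "card_D K = |gS_less K natLeq {}|"

section \<open>Stability, order property, tameness\<close>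

text \<open>
  As ordinals, \<open>natLeq_on 2\<close> is \<open>2\<close> and \<open>natLeq\<close> is \<open>\<omega>\<close>; as a cardinal, \<open>natLeq\<close> is \<open>\<aleph>\<^sub>0\<close>.
\<close>

definition stable_in :: "('u, 'f, 'r) abstract_class \<Rightarrow> 'u rel \<Rightarrow> bool" where
  "stable_in K \<mu> \<longleftrightarrow>
     (\<forall>M \<in> models K. \<forall>A \<subseteq> carrier M. |A| \<le>o \<mu> \<longrightarrow> |gS_less_in K (natLeq_on 2) A M| \<le>o \<mu>)"

definition stable_class :: "('u, 'f, 'r) abstract_class \<Rightarrow> bool" where
  "stable_class K \<longleftrightarrow> (\<exists>\<mu> :: 'u rel. Card_order \<mu> \<and> small \<mu> \<and> LS K \<le>o \<mu> \<and> stable_in K \<mu>)"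

definition first_stability_cardinal :: "('u, 'f, 'r) abstract_class \<Rightarrow> 'u rel" where
  "first_stability_cardinal K = least_card (\<lambda>\<mu>. small \<mu> \<and> LS K \<le>o \<mu> \<and> stable_in K \<mu>)"

text \<open>The variant in which infinite cardinals below \<open>LS K\<close> are allowed as well.\<close>

definition first_infinite_stability_cardinal :: "('u, 'f, 'r) abstract_class \<Rightarrow> 'u rel" where
  "first_infinite_stability_cardinal K =
     least_card (\<lambda>\<mu>. small \<mu> \<and> natLeq \<le>o \<mu> \<and> stable_in K \<mu>)"

text \<open>
  The concatenation of two sequences of length \<open>\<beta>\<close> is indexed by the disjoint union of two copies
  of \<open>Field \<beta>\<close>; the order of the index set plays no role for Galois types.
\<close>

definition order_property ::
  "('u, 'f, 'r) abstract_class \<Rightarrow> 'i rel \<Rightarrow> 'm rel \<Rightarrow> bool" where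
  "order_property K \<beta> \<mu> \<longleftrightarrow>
     (\<exists>M \<in> models K. \<exists>a :: 'm \<Rightarrow> 'i \<rightharpoonup> 'u.
        (\<forall>i \<in> Field \<mu>. dom (a i) = Field \<beta> \<and> ran (a i) \<subseteq> carrier M) \<and>
        (\<forall>i0 i1 j0 j1. (i0, i1) \<in> \<mu> \<and> i0 \<noteq> i1 \<and> (j0, j1) \<in> \<mu> \<and> j0 \<noteq> j1 \<longrightarrow>
           gtp K (case_sum (a i0) (a i1)) {} M \<noteq> gtp K (case_sum (a j1) (a j0)) {} M))"

definition order_property_less ::
  "('u, 'f, 'r) abstract_class \<Rightarrow> 'i rel \<Rightarrow> 'm rel \<Rightarrow> bool" where
  "order_property_less K \<alpha> \<mu> \<longleftrightarrow>
     (\<exists>\<beta> \<in> ordinals_below \<alpha>. Field \<beta> \<noteq> {} \<and> order_property K \<beta> \<mu>)"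

definition tame_less :: "('u, 'f, 'r) abstract_class \<Rightarrow> 'k rel \<Rightarrow> bool" where
  "tame_less K \<kappa> \<longleftrightarrow>
     (\<forall>A. (\<exists>M \<in> models K. A \<subseteq> carrier M) \<longrightarrow>
        (\<forall>p \<in> gS_less K (natLeq_on 2) A. \<forall>q \<in> gS_less K (natLeq_on 2) A. p \<noteq> q \<longrightarrow>
           (\<exists>A0 \<subseteq> A. |A0| <o \<kappa> \<and> gtp_restrict K p A0 \<noteq> gtp_restrict K q A0)))"

definition tame :: "('u, 'f, 'r) abstract_class \<Rightarrow> 'k rel \<Rightarrow> bool" where
  "tame K \<mu> \<longleftrightarrow> tame_less K (cardSuc \<mu>)"

section \<open>Well-definedness\<close>

lemma least_card:
  assumes "Card_order \<mu>" "P \<mu>"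
  shows "Card_order (least_card P) \<and> P (least_card P) \<and>
    (\<forall>\<nu>. Card_order \<nu> \<and> P \<nu> \<longrightarrow> least_card P \<le>o \<nu>)"
proof -
  obtain m where m: "m \<in> {\<nu>. Card_order \<nu> \<and> P \<nu>}"
    and min: "\<And>y. (y, m) \<in> ordLess \<Longrightarrow> y \<notin> {\<nu>. Card_order \<nu> \<and> P \<nu>}"
    using wfE_min[OF wf_ordLess, of \<mu> "{\<nu>. Card_order \<nu> \<and> P \<nu>}"] assms by blast
  have cm: "Card_order m" and Pm: "P m" using m by simp_all
  have le: "m \<le>o \<nu>" if \<nu>: "Card_order \<nu>" "P \<nu>" for \<nu>
  proof (rule ccontr)
    assume "\<not> m \<le>o \<nu>"
    then have "\<nu> <o m"
      using not_ordLeq_iff_ordLess[OF card_order_on_well_order_on[OF \<nu>(1)]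
          card_order_on_well_order_on[OF cm]] by simp
    then show False using min[of \<nu>] \<nu> by simp
  qed
  show ?thesis
    unfolding least_card_def by (rule someI[of _ m]) (simp add: cm Pm le)
qed

lemma exp2_less:
  fixes \<theta> :: "'a rel"
  shows "Card_order (exp2_less \<theta>)"
    and "Card_order (\<nu> :: 'a rel) \<Longrightarrow> \<nu> <o \<theta> \<Longrightarrow> exp2 \<nu> \<le>o exp2_less \<theta>"
    and "Card_order \<chi> \<Longrightarrow> (\<And>\<nu> :: 'a rel. Card_order \<nu> \<Longrightarrow> \<nu> <o \<theta> \<Longrightarrow> exp2 \<nu> \<le>o \<chi>) \<Longrightarrow>
      exp2_less \<theta> \<le>o \<chi>"
proof -
  have bd: "exp2 \<nu> \<le>o |UNIV :: 'a set set|" for \<nu> :: "'a rel"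
  proof -
    have "|Func (Field \<nu>) (UNIV :: bool set)| \<le>o |UNIV :: 'a set set|"
      unfolding card_of_ordLeq[symmetric]
      by (rule exI[of _ "\<lambda>f. {x \<in> Field \<nu>. f x}"]) (auto simp: inj_on_def Func_def fun_eq_iff set_eq_iff)
    then show ?thesis by (simp add: cexp_def ctwo_def Field_card_of)
  qed
  have *: "Card_order (exp2_less \<theta>) \<and>
      (\<forall>\<nu> :: 'a rel. Card_order \<nu> \<and> \<nu> <o \<theta> \<longrightarrow> exp2 \<nu> \<le>o exp2_less \<theta>) \<and>
      (\<forall>\<chi> :: 'a set rel. Card_order \<chi> \<and>
         (\<forall>\<nu> :: 'a rel. Card_order \<nu> \<and> \<nu> <o \<theta> \<longrightarrow> exp2 \<nu> \<le>o \<chi>) \<longrightarrow> exp2_less \<theta> \<le>o \<chi>)"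
    unfolding exp2_less_def by (rule least_card[OF card_of_Card_order]) (use bd in blast)
  then show "Card_order (exp2_less \<theta>)" by blast
  show "exp2 \<nu> \<le>o exp2_less \<theta>" if "Card_order (\<nu> :: 'a rel)" "\<nu> <o \<theta>"
    using * that by blast
  have min: "exp2_less \<theta> \<le>o \<chi>"
    if "Card_order \<chi>" "\<And>\<nu> :: 'a rel. Card_order \<nu> \<Longrightarrow> \<nu> <o \<theta> \<Longrightarrow> exp2 \<nu> \<le>o \<chi>"
    for \<chi> :: "'a set rel"
    using * that by blast
  assume c: "Card_order \<chi>" and b: "\<And>\<nu> :: 'a rel. Card_order \<nu> \<Longrightarrow> \<nu> <o \<theta> \<Longrightarrow> exp2 \<nu> \<le>o \<chi>"
  show "exp2_less \<theta> \<le>o \<chi>"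
  proof (cases "|UNIV :: 'a set set| \<le>o \<chi>")
    case True
    have "exp2_less \<theta> \<le>o |UNIV :: 'a set set|" by (rule min[OF card_of_Card_order bd])
    then show ?thesis using True ordLeq_transitive by blast
  next
    case False
    then have "\<chi> \<le>o |UNIV :: 'a set set|"
      using ordLeq_total[OF card_order_on_well_order_on[OF c] card_of_Well_order] by blast
    then have "|Field \<chi>| \<le>o |UNIV :: 'a set set|"
      by (rule ordIso_ordLeq_trans[OF card_of_Field_ordIso[OF c]])
    then have "\<exists>f. inj_on f (Field \<chi>) \<and> f ` Field \<chi> \<subseteq> (UNIV :: 'a set set)"
      by (rule card_of_ordLeq[THEN iffD2])
    then obtain f :: "_ \<Rightarrow> 'a set" where "inj_on f (Field \<chi>)" by (elim exE conjE)
    then have "bij_betw f (Field \<chi>) (f ` Field \<chi>)" by (rule inj_on_imp_bij_betw)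
    then have "|Field \<chi>| =o |f ` Field \<chi>|" by (rule card_of_ordIsoI)
    then have e: "\<chi> =o |f ` Field \<chi>|"
      by (rule ordIso_transitive[OF ordIso_symmetric[OF card_of_Field_ordIso[OF c]]])
    have "exp2_less \<theta> \<le>o |f ` Field \<chi>|"
      by (rule min[OF card_of_Card_order ordLeq_ordIso_trans[OF b e]])
    then show ?thesis by (rule ordLeq_ordIso_trans[OF _ ordIso_symmetric[OF e]])
  qed
qed

context AEC
begin

lemma LS_is_LS_bound: "Card_order (LS K) \<and> is_LS_bound K (LS K)"
proof -
  obtain \<theta> :: "'u rel" where "Card_order \<theta>" "is_LS_bound K \<theta>"
    using LS_axiom by (elim exE conjE)
  from least_card[of \<theta> "is_LS_bound K", OF this] show ?thesis
    unfolding LS_def by (elim conjE) (intro conjI)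
qed

lemma K_embedding_id: "M \<in> models K \<Longrightarrow> K_embedding K id M M"
  unfolding K_embedding_def is_iso_def by (intro bexI[of _ M]) (simp_all add: strong_refl)

lemma gal_step_iff:
  "((a, A, M), (b, B, N)) \<in> gal_step K \<longleftrightarrow> B = A \<and>
     M \<in> models K \<and> N \<in> models K \<and> A \<subseteq> carrier M \<and> A \<subseteq> carrier N \<and>
     ran a \<subseteq> carrier M \<and> ran b \<subseteq> carrier N \<and>
     (\<exists>L \<in> models K. \<exists>f g. K_embedding K f M L \<and> K_embedding K g N L \<and>
        (\<forall>x \<in> A. f x = x \<and> g x = x) \<and> map_option f \<circ> a = map_option g \<circ> b)"
  unfolding gal_step_def by (simp cong: conj_cong)

lemma gal_step_refl:
  assumes "M \<in> models K" "A \<subseteq> carrier M" "ran a \<subseteq> carrier M"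
  shows "((a, A, M), (a, A, M)) \<in> gal_step K"
  unfolding gal_step_iff using assms K_embedding_id[OF assms(1)]
  by (intro conjI bexI[of _ M] exI[of _ id]) simp_all

lemma sym_gal_step: "sym (gal_step K :: ('i, 'u, 'f, 'r) triple rel)"
proof (rule symI)
  fix s t :: "('i, 'u, 'f, 'r) triple"
  assume st: "(s, t) \<in> gal_step K"
  obtain a A M where s: "s = (a, A, M)" by (cases s)
  obtain b B N where t: "t = (b, B, N)" by (cases t)
  from st show "(t, s) \<in> gal_step K"
    unfolding s t gal_step_iff by (elim conjE bexE exE, intro conjI bexI exI) (assumption | simp)+
qed

lemma gtp_eqI:
  assumes "((a, A, M), (b, B, N)) \<in> (gal_step K)\<^sup>+"
  shows "gtp K a A M = gtp K b B N"
proof -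
  have "((b, B, N), (a, A, M)) \<in> (gal_step K)\<^sup>+"
    using symD[OF sym_trancl[OF sym_gal_step] assms] .
  with assms show ?thesis
    unfolding gtp_def by (auto simp only: Image_singleton_iff intro: trancl_trans)
qed

lemma gtp_eq_iff:
  assumes "M \<in> models K" "A \<subseteq> carrier M" "ran a \<subseteq> carrier M"
    and "N \<in> models K" "B \<subseteq> carrier N" "ran b \<subseteq> carrier N"
  shows "gtp K a A M = gtp K b B N \<longleftrightarrow> ((a, A, M), (b, B, N)) \<in> (gal_step K)\<^sup>+"
proof -
  have "(b, B, N) \<in> gtp K b B N"
    unfolding gtp_def Image_singleton_iff by (rule r_into_trancl[OF gal_step_refl[OF assms(4-6)]])
  then show ?thesis using gtp_eqI by (metis gtp_def Image_singleton_iff)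
qed

lemma gtp_restrict_gtp:
  assumes "M \<in> models K" "A \<subseteq> carrier M" "ran a \<subseteq> carrier M" "A0 \<subseteq> A"
  shows "gtp_restrict K (gtp K a A M) A0 = gtp K a A0 M"
proof -
  have step_restrict: "C = B \<and> ((b, A0, N), (c, A0, P)) \<in> gal_step K"
    if "((b, B, N), (c, C, P)) \<in> gal_step K" "A0 \<subseteq> B" for b B N c C P
    using that unfolding gal_step_iff by (meson subset_eq)
  have *: "fst (snd t) = A \<and> ((a, A0, M), (fst t, A0, snd (snd t))) \<in> (gal_step K)\<^sup>+"
    if "((a, A, M), t) \<in> (gal_step K)\<^sup>+" for t
    using that
  proof (induction rule: trancl_induct)
    case (base t)
    obtain b B N where t: "t = (b, B, N)" by (cases t)
    show ?case using step_restrict[OF base[unfolded t] assms(4)] r_into_trancl unfolding t by auto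
  next
    case (step t u)
    obtain b B N where t: "t = (b, B, N)" by (cases t)
    obtain c C P where u: "u = (c, C, P)" by (cases u)
    have IH: "B = A" "((a, A0, M), (b, A0, N)) \<in> (gal_step K)\<^sup>+"
      using step.IH unfolding t by simp_all
    have "C = B \<and> ((b, A0, N), (c, A0, P)) \<in> gal_step K"
      using step_restrict[OF step.hyps(2)[unfolded t u]] IH(1) assms(4) by simp
    then show ?case
      using IH trancl_into_trancl[OF IH(2)] unfolding u by simp
  qed
  have const: "gtp K b A0 N = gtp K a A0 M" if "(b, B, N) \<in> gtp K a A M" for b B N
  proof -
    have "((a, A0, M), (b, A0, N)) \<in> (gal_step K)\<^sup>+"
      using *[of "(b, B, N)"] that unfolding gtp_def by simp
    then show ?thesis by (rule gtp_eqI[symmetric])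
  qed
  have self: "(a, A, M) \<in> gtp K a A M"
    unfolding gtp_def Image_singleton_iff by (rule r_into_trancl[OF gal_step_refl[OF assms(1-3)]])
  show ?thesis
    unfolding gtp_restrict_def
  proof (intro equalityI UN_least)
    fix t assume t: "t \<in> gtp K a A M"
    obtain b B N where "t = (b, B, N)" by (cases t)
    then show "(case t of (a, A, M) \<Rightarrow> gtp K a A0 M) \<subseteq> gtp K a A0 M"
      using const t by simp
  next
    show "gtp K a A0 M \<subseteq> (\<Union>(a, A, M) \<in> gtp K a A M. gtp K a A0 M)"
      using UN_upper[OF self, of "\<lambda>(a, A, M). gtp K a A0 M"] by simp
  qed
qed

end

end

(*
  Fix a model M and write T x b for the type of the concatenation of an element x and a sequence b over
  the empty set.  By tameness, the type of x over A is determined by the types T x b of the short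
  sequences b from A.  Let chi be the length for which the order property fails and let theta bound the
  number of classes of short sequences that fewer than chi elements can distinguish.  If more than
  2^theta types over a set of size at most 2^theta were realized in M, then some x would split over
  every subset of size less than chi of a suitably saturated extension of that set, and a sequence of
  length chi of splitting witnesses would have the order property.  The bounds follow with
  theta = 2^{<chi} in (2) and theta = 2^chi in (3) and (4).  In (2) a sequence of length beta has at
  most 2^(beta + LS(K)) types over the empty set, so fewer than chi elements distinguish at most
  2^{<chi} classes of such sequences.
*)

theory Submission
  imports Defs "HOL-Library.FuncSet"
begin

section \<open>Cardinal arithmetic\<close>

text \<open>Amalgamation is not assumed, so there is no monster model, and equality of Galois types
  is only the transitive closure of one-step amalgamation. Two choices get around this. All
  realizations are sought inside the fixed \<open>M\<close>: the saturated extension only has to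
  realize types that elements of \<open>M\<close> already realize, and \<open>stable_in\<close>
  counts types in one model at a time. And \<open>T x b\<close> is a type over the empty set, the
  only kind that the order property mentions; that it controls the type of \<open>x\<close> over
  \<open>ran b\<close> needs an argument of its own, in which every model of the connecting chain is
  renamed. The splitting triples \<open>x i\<close>, \<open>b i\<close>, \<open>c i\<close> are
  built so that for \<open>i < j\<close> the element \<open>x i\<close> does not separate
  \<open>b j\<close> from \<open>c j\<close>, while \<open>x j\<close> separates \<open>b i\<close>
  from \<open>c i\<close>. Hence an increasing pair never has the type of a decreasing pair. The
  size \<open>2^\<theta>\<close> comes from \<open>(2^\<theta>)^\<theta> = 2^\<theta>\<close>: types
  over \<open>\<theta>\<close> sequences, subsets of size \<open>\<theta>\<close> and functions on
  \<open>\<theta>\<close> classes are all counted by it.\<close>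

lemma card_of_image_kernel:
  assumes "\<And>x y. x \<in> X \<Longrightarrow> y \<in> X \<Longrightarrow> g x = g y \<Longrightarrow> f x = f y"
  shows "|f ` X| \<le>o |g ` X|"
proof (rule surj_imp_ordLeq[where f = "\<lambda>z. f (SOME x. x \<in> X \<and> g x = z)"], rule image_subsetI)
  fix x assume x: "x \<in> X"
  define y where "y = (SOME y. y \<in> X \<and> g y = g x)"
  have "y \<in> X \<and> g y = g x"
    unfolding y_def by (rule someI[of _ x]) (use x in simp)
  then have "f x = f y" using assms x by metis
  then show "f x \<in> (\<lambda>z. f (SOME x. x \<in> X \<and> g x = z)) ` (g ` X)"
    using x unfolding y_def by blast
qed

lemma card_of_Pow_exp2: "|Pow X| =o exp2 |X|"
  using card_of_Pow_Func[of X] by (simp add: cexp_def ctwo_def Field_card_of)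

lemma exp2_mono:
  assumes "r \<le>o s"
  shows "exp2 r \<le>o exp2 s"
proof -
  obtain f where f: "inj_on f (Field r)" "f ` Field r \<subseteq> Field s"
    using card_of_mono2[OF assms] card_of_ordLeq[of "Field r" "Field s"] by blast
  have "|Pow (Field r)| \<le>o |Pow (Field s)|"
    by (rule card_of_ordLeqI[where f = "image f"]) (use f in \<open>auto simp: inj_on_image_Pow\<close>)
  moreover have "|Pow (Field t)| =o exp2 t" for t
    using card_of_Pow_Func by (simp add: cexp_def ctwo_def Field_card_of)
  ultimately show ?thesis
    using ordIso_ordLeq_trans ordLeq_ordIso_trans ordIso_symmetric by metis
qed

lemma card_of_Pow_le_exp2:
  assumes "|X| \<le>o r"
  shows "|Pow X| \<le>o exp2 r"
  using ordIso_ordLeq_trans[OF card_of_Pow_exp2 exp2_mono[OF assms]] .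

lemma Cinfinite_exp2: "Cinfinite r \<Longrightarrow> Cinfinite (exp2 r)"
  by (simp add: Cinfinite_cexp ordLeq_refl Card_order_ctwo)

lemma ordLeq_exp2: "Card_order r \<Longrightarrow> r \<le>o exp2 r"
  by (simp add: ordLess_ctwo_cexp ordLess_imp_ordLeq)

text \<open>This is \<open>(2^\<theta>)^\<theta> = 2^\<theta>\<close>. An empty \<open>S\<close> is
  treated apart because exponentiation is not monotone in the exponent at
  \<open>0^0 = 1\<close>.\<close>

lemma card_of_Func_exp2:
  assumes th: "Cinfinite \<theta>" and S: "|S| \<le>o \<theta>" and V: "|V| \<le>o exp2 \<theta>"
  shows "|Func S V| \<le>o exp2 \<theta>"
proof (cases "S = {}")
  case True
  then have "Func S V \<subseteq> {\<lambda>_. undefined}" by (auto simp: Func_def)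
  then have "finite (Func S V)" by (rule finite_subset) simp
  then have "|Func S V| \<le>o natLeq"
    using finite_iff_ordLess_natLeq ordLess_imp_ordLeq by blast
  also have "natLeq \<le>o exp2 \<theta>"
    by (rule natLeq_ordLeq_cinfinite[OF Cinfinite_exp2[OF th]])
  finally show ?thesis .
next
  case False
  have "|Func S V| = |V| ^c |S|" by (simp add: cexp_def Field_card_of)
  also have "|V| ^c |S| \<le>o exp2 \<theta> ^c \<theta>"
    using False by (intro cexp_mono' V S) (simp add: Field_card_of)
  also have "exp2 \<theta> ^c \<theta> =o exp2 \<theta>"
    by (rule cexp_cprod_ordLeq[OF Card_order_ctwo th Cinfinite_Cnotzero[OF th]])
      (use th ordLeq_refl in blast)
  finally show ?thesis .
qed

text \<open>The hypothesis on kernels makes \<open>f\<close> factor through the function that lists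
  the coordinates \<open>h s x\<close>, and there are at most \<open>(2^\<theta>)^\<theta>\<close>
  such lists. In the applications the coordinates are entries of a sequence, types of an element
  with few sequences, or restrictions to the sequences over one index set.\<close>

lemma card_of_image_family:
  assumes th: "Cinfinite \<theta>" and S: "|S| \<le>o \<theta>" and h: "\<And>s. s \<in> S \<Longrightarrow> |h s ` X| \<le>o exp2 \<theta>"
    and ker: "\<And>x y. x \<in> X \<Longrightarrow> y \<in> X \<Longrightarrow> (\<And>s. s \<in> S \<Longrightarrow> h s x = h s y) \<Longrightarrow> f x = f y"
  shows "|f ` X| \<le>o exp2 \<theta>"
proof -
  let ?g = "\<lambda>x. restrict (\<lambda>s. h s x) S"
  have "|f ` X| \<le>o |?g ` X|"
    by (rule card_of_image_kernel) (metis ker restrict_apply')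
  also have "|?g ` X| \<le>o |Func S (\<Union>s \<in> S. h s ` X)|"
    by (rule card_of_mono1) (fastforce simp: Func_def)
  also have "|Func S (\<Union>s \<in> S. h s ` X)| \<le>o exp2 \<theta>"
  proof (rule card_of_Func_exp2[OF th S UNION_Cinfinite_bound])
    show "|S| \<le>o exp2 \<theta>"
      using S ordLeq_exp2 th ordLeq_transitive by blast
  qed (use h Cinfinite_exp2[OF th] in auto)
  finally show ?thesis .
qed

text \<open>A nonempty set of size at most \<open>\<theta>\<close> is the range of a function on
  \<open>Field \<theta>\<close>, so the count is again \<open>(2^\<theta>)^\<theta>\<close>.\<close>

lemma card_of_subsets_exp2:
  assumes th: "Cinfinite \<theta>" and Y: "|Y| \<le>o exp2 \<theta>"
  shows "|{S. S \<subseteq> Y \<and> |S| \<le>o \<theta>}| \<le>o exp2 \<theta>"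
proof -
  let ?I = "(\<lambda>f. f ` Field \<theta>) ` Func (Field \<theta>) Y"
  have "{S. S \<subseteq> Y \<and> |S| \<le>o \<theta>} \<subseteq> {{}} \<union> ?I"
  proof
    fix S assume S: "S \<in> {S. S \<subseteq> Y \<and> |S| \<le>o \<theta>}"
    show "S \<in> {{}} \<union> ?I"
    proof (cases "S = {}")
      case False
      have "|S| \<le>o |Field \<theta>|"
        using S th card_of_mono2[of "|S|" \<theta>] by (simp add: Field_card_of)
      then obtain g where g: "g ` Field \<theta> = S"
        using card_of_ordLeq2[OF False, of "Field \<theta>"] by blast
      have "restrict g (Field \<theta>) \<in> Func (Field \<theta>) Y" "restrict g (Field \<theta>) ` Field \<theta> = S"
        using g S by (auto simp: Func_def)
      then show ?thesis by blast
    qed simp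
  qed
  then have "|{S. S \<subseteq> Y \<and> |S| \<le>o \<theta>}| \<le>o |{{}} \<union> ?I|" by (rule card_of_mono1)
  also have "|{{}} \<union> ?I| \<le>o exp2 \<theta>"
  proof (rule Un_Cinfinite_bound[OF _ _ Cinfinite_exp2[OF th]])
    show "|{{}}| \<le>o exp2 \<theta>"
      using Cinfinite_exp2[OF th] by (intro Card_order_singl_ordLeq) (auto simp: cinfinite_def)
    show "|?I| \<le>o exp2 \<theta>"
      using card_of_image card_of_Func_exp2[OF th _ Y] th card_of_Field_ordIso[of \<theta>]
        ordLeq_transitive ordIso_imp_ordLeq by blast
  qed
  finally show ?thesis .
qed

text \<open>The closure is the union of an increasing chain of length \<open>\<theta>^+\<close>.
  Regularity of \<open>\<theta>^+\<close> puts every subset of size at most \<open>\<theta>\<close>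
  into a single stage, whose successors absorb its image under \<open>G\<close>; and
  \<open>\<theta>^+ \<le> 2^\<theta>\<close> keeps the union small.\<close>

lemma bounded_closure:
  assumes th: "Cinfinite \<theta>" and A: "A \<subseteq> U" "|A| \<le>o exp2 \<theta>"
    and G: "\<And>S. S \<subseteq> U \<Longrightarrow> |S| \<le>o \<theta> \<Longrightarrow> G S \<subseteq> U \<and> |G S| \<le>o exp2 \<theta>"
  obtains A' where "A \<subseteq> A'" "A' \<subseteq> U" "|A'| \<le>o exp2 \<theta>"
    "\<And>S. S \<subseteq> A' \<Longrightarrow> |S| \<le>o \<theta> \<Longrightarrow> G S \<subseteq> A'"
proof -
  let ?r = "cardSuc \<theta>"
  have inf: "Cinfinite (exp2 \<theta>)" and cs: "Card_order ?r"
    using Cinfinite_exp2[OF th] cardSuc_Card_order th by auto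
  have wo: "Well_order ?r" using cs card_order_on_well_order_on by blast
  have wf: "wf (?r - Id)" using wo by (simp add: wo_rel.WF wo_rel_def)
  \<comment> \<open>Stage \<open>i\<close> collects all earlier stages together with
    \<open>G\<close> of their small subsets. No case split on limits is needed, and the chain is
    increasing by construction.\<close>
  let ?P = "\<lambda>f i X. X = A \<union> (\<Union>j \<in> {j. (j, i) \<in> ?r - Id}.
      f j \<union> (\<Union>S \<in> {S. S \<subseteq> f j \<and> |S| \<le>o \<theta>}. G S))"
  have "\<exists>f. \<forall>i. ?P f i (f i)"
    by (rule dependent_wf_choice[OF wf]) auto
  then obtain f where f: "\<And>i. ?P f i (f i)" by blast
  have r_le: "|Field ?r| \<le>o exp2 \<theta>"
  proof -
    have "|Field ?r| \<le>o ?r" using card_of_Field_ordIso[OF cs] ordIso_imp_ordLeq by blast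
    also have "?r \<le>o exp2 \<theta>"
      using th inf by (intro cardSuc_least ordLess_ctwo_cexp) auto
    finally show ?thesis .
  qed
  have bd: "f i \<subseteq> U \<and> |f i| \<le>o exp2 \<theta>" for i
    using wf
  proof (induction i rule: wf_induct_rule)
    case (less i)
    have step: "f j \<union> (\<Union>S \<in> {S. S \<subseteq> f j \<and> |S| \<le>o \<theta>}. G S) \<subseteq> U"
      "|f j \<union> (\<Union>S \<in> {S. S \<subseteq> f j \<and> |S| \<le>o \<theta>}. G S)| \<le>o exp2 \<theta>"
      if j: "(j, i) \<in> ?r - Id" for j
    proof -
      have fj: "f j \<subseteq> U" "|f j| \<le>o exp2 \<theta>" using less[OF j] by auto
      show "f j \<union> (\<Union>S \<in> {S. S \<subseteq> f j \<and> |S| \<le>o \<theta>}. G S) \<subseteq> U"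
        using fj G by blast
      have "|\<Union>S \<in> {S. S \<subseteq> f j \<and> |S| \<le>o \<theta>}. G S| \<le>o exp2 \<theta>"
        by (rule UNION_Cinfinite_bound[OF card_of_subsets_exp2[OF th fj(2)] _ inf])
          (use fj G in blast)
      then show "|f j \<union> (\<Union>S \<in> {S. S \<subseteq> f j \<and> |S| \<le>o \<theta>}. G S)| \<le>o exp2 \<theta>"
        by (rule Un_Cinfinite_bound[OF fj(2) _ inf])
    qed
    have "{j. (j, i) \<in> ?r - Id} \<subseteq> Field ?r" by (auto simp: Field_def)
    then have J: "|{j. (j, i) \<in> ?r - Id}| \<le>o exp2 \<theta>"
      by (rule ordLeq_transitive[OF card_of_mono1 r_le])
    have "|f i| \<le>o exp2 \<theta>"
      by (subst f, rule Un_Cinfinite_bound[OF A(2) UNION_Cinfinite_bound[OF J _ inf] inf])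
        (use step(2) in blast)
    moreover have "f i \<subseteq> U" by (subst f) (use step(1) A(1) in blast)
    ultimately show ?case by blast
  qed
  have mono: "f j \<subseteq> f i" if "(j, i) \<in> ?r" for i j
    using that f[of i] by (cases "j = i") auto
  define A' where "A' = (\<Union>i \<in> Field ?r. f i)"
  show thesis
  proof
    have "Field ?r \<noteq> {}" using th by (intro Field_cardSuc_not_empty) auto
    then show "A \<subseteq> A'" unfolding A'_def using f by blast
    show "A' \<subseteq> U" unfolding A'_def using bd by blast
    show "|A'| \<le>o exp2 \<theta>"
      unfolding A'_def by (rule UNION_Cinfinite_bound[OF r_le _ inf]) (use bd in blast)
  next
    fix S assume S: "S \<subseteq> A'" "|S| \<le>o \<theta>"
    have "relChain ?r f" unfolding relChain_def using mono by blast
    then obtain i where i: "i \<in> Field ?r" "S \<subseteq> f i"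
      using cardSuc_UNION_Cinfinite[OF th _ S(1)[unfolded A'_def] S(2)] by blast
    have "\<not> finite (Field ?r)"
      using Cinfinite_cardSuc[OF th] by (simp add: cinfinite_def)
    \<comment> \<open>\<open>G S\<close> enters only strictly after the stage that contains
      \<open>S\<close>; a later stage exists because an infinite cardinal has no last
      element.\<close>
    then obtain k where k: "k \<in> Field ?r" "i \<noteq> k" "(i, k) \<in> ?r"
      using infinite_Card_order_limit[OF cs _ i(1)] by blast
    have "G S \<subseteq> f k" using f[of k] k i S by auto
    then show "G S \<subseteq> A'" using k unfolding A'_def by blast
  qed
qed

text \<open>The supremum in \<open>exp2_less\<close> ranges over cardinals carried by
  \<open>'a\<close>, so \<open>X\<close> is first exchanged for an equinumerous set of elements of
  \<open>'a\<close>.\<close>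

lemma Pow_le_exp2_less:
  fixes \<theta> :: "'a rel"
  assumes "|X| <o \<theta>"
  shows "|Pow X| \<le>o exp2_less \<theta>"
proof -
  from assms[unfolded internalize_card_of_ordLess[of X \<theta>]]
  obtain B :: "'a set" where B: "|X| =o |B|" "|B| <o \<theta>" by (elim exE conjE)
  have "|Pow X| =o exp2 |X|" by (rule card_of_Pow_exp2)
  also have "exp2 |X| =o exp2 |B|"
    by (rule cexp_cong2[OF B(1) Card_order_ctwo card_of_Card_order])
  also have "exp2 |B| \<le>o exp2_less \<theta>"
    by (rule exp2_less(2)[OF card_of_Card_order B(2)])
  finally show ?thesis .
qed

text \<open>Otherwise \<open>\<lambda> = 2^{<\<theta>}\<close> is itself below
  \<open>\<theta>\<close>, so that \<open>2^\<lambda> \<le> \<lambda>\<close>, against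
  Cantor.\<close>

lemma ordLeq_exp2_less:
  assumes "Card_order \<theta>"
  shows "\<theta> \<le>o exp2_less \<theta>"
proof (rule ccontr)
  assume "\<not> \<theta> \<le>o exp2_less \<theta>"
  then have less: "exp2_less \<theta> <o \<theta>"
    using not_ordLeq_iff_ordLess assms exp2_less(1) card_order_on_well_order_on by metis
  have "|Pow (Field (exp2_less \<theta>))| \<le>o exp2_less \<theta>"
    by (rule Pow_le_exp2_less[OF ordLess_Field[OF less]])
  moreover have "exp2_less \<theta> <o |Pow (Field (exp2_less \<theta>))|"
    by (rule Card_order_Pow[OF exp2_less(1)])
  ultimately show False using not_ordLess_ordLeq by blast
qed

lemma exp2_less_le_exp2: "Card_order \<theta> \<Longrightarrow> exp2_less \<theta> \<le>o exp2 \<theta>"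
  by (rule exp2_less(3)[OF Card_order_cexp exp2_mono[OF ordLess_imp_ordLeq]])

section \<open>Counting types over a set\<close>

text \<open>The index set is bare; a well-ordered length is restored only when an order property is
  produced, by spreading the entries over the field of a well-order.\<close>

definition seqs :: "'i set \<Rightarrow> 'u set \<Rightarrow> ('i \<rightharpoonup> 'u) set" where
  "seqs J X = {b. dom b = J \<and> ran b \<subseteq> X}"

lemma seqs_mono: "X \<subseteq> Y \<Longrightarrow> seqs J X \<subseteq> seqs J Y"
  unfolding seqs_def by blast

lemma ran_eq_image_dom: "ran b = (\<lambda>i. the (b i)) ` dom b"
  by (force simp: ran_def image_def)

lemma card_of_seqs:
  assumes th: "Cinfinite \<theta>" and J: "|J| \<le>o \<theta>" and X: "|X| \<le>o exp2 \<theta>"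
  shows "|seqs J X| \<le>o exp2 \<theta>"
proof -
  have "|id ` seqs J X| \<le>o exp2 \<theta>"
  proof (rule card_of_image_family[OF th J, where h = "\<lambda>i b. b i"])
    fix i assume i: "i \<in> J"
    have "(\<lambda>b. b i) ` seqs J X \<subseteq> Some ` X"
      using i by (auto simp: seqs_def ran_def dom_def)
    then show "|(\<lambda>b. b i) ` seqs J X| \<le>o exp2 \<theta>"
      using ordLeq_transitive[OF card_of_mono1 ordLeq_transitive[OF card_of_image X]] by blast
  next
    fix b c assume bc: "b \<in> seqs J X" "c \<in> seqs J X" and eq: "\<And>i. i \<in> J \<Longrightarrow> b i = c i"
    have "b i = c i" for i
      using bc eq by (cases "i \<in> J") (auto simp: seqs_def)
    then show "id b = id c" by auto
  qed
  then show ?thesis by simp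
qed

text \<open>
  The set \<open>A\<close> is enlarged to a set \<open>A'\<close> of the same size that realizes every type over few sequences.
  If every \<open>x\<close> is nonsplitting over some small \<open>B \<subseteq> A'\<close>, then its type is given by \<open>B\<close> and a function on
  the few classes of sequences that \<open>B\<close> cannot tell apart.  Otherwise splitting of one fixed \<open>x\<close>,
  iterated \<open>\<chi>\<close> times inside \<open>A'\<close>, yields the order property.  The index set \<open>J\<close> is fixed before
  splitting, so that all sequences in the resulting order have the same length.
\<close>

theorem card_of_types_if_no_order:
  fixes T :: "'u \<Rightarrow> ('i \<rightharpoonup> 'u) \<Rightarrow> 't" and \<theta> :: "'h rel" and \<chi> :: "'c rel"
  assumes th: "Cinfinite \<theta>" and ch: "Card_order \<chi>" "\<chi> \<le>o \<theta>"
    and JJ: "|JJ| \<le>o \<theta>" and J: "\<And>J. J \<in> JJ \<Longrightarrow> |J| \<le>o \<theta>"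
    and types: "\<And>J. J \<in> JJ \<Longrightarrow> |(\<lambda>(x, b). T x b) ` (U \<times> seqs J U)| \<le>o exp2 \<theta>"
    and classes: "\<And>J B. J \<in> JJ \<Longrightarrow> B \<subseteq> U \<Longrightarrow> |B| <o \<chi> \<Longrightarrow>
      |(\<lambda>b. restrict (\<lambda>y. T y b) B) ` seqs J U| \<le>o \<theta>"
    and no_order: "\<And>J x b c. J \<in> JJ \<Longrightarrow>
      (\<And>i. i \<in> Field \<chi> \<Longrightarrow> x i \<in> U \<and> b i \<in> seqs J U \<and> c i \<in> seqs J U) \<Longrightarrow>
      (\<And>i j. (i, j) \<in> \<chi> \<Longrightarrow> i \<noteq> j \<Longrightarrow>
         T (x i) (b j) = T (x i) (c j) \<and> T (x j) (b i) \<noteq> T (x j) (c i)) \<Longrightarrow> False"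
    and A: "A \<subseteq> U" "|A| \<le>o exp2 \<theta>"
  shows "|(\<lambda>x. restrict (T x) (\<Union>J \<in> JJ. seqs J A)) ` U| \<le>o exp2 \<theta>"
proof -
  have inf: "Cinfinite (exp2 \<theta>)" by (rule Cinfinite_exp2[OF th])
  have th_le: "\<theta> \<le>o exp2 \<theta>" using ordLeq_exp2 th by blast
  have le_th: "|X| \<le>o exp2 \<theta>" if "|X| \<le>o \<theta>" for X :: "'x set"
    by (rule ordLeq_transitive[OF that th_le])
  \<comment> \<open>The chosen element depends only on the values \<open>T x b\<close> for
    \<open>b \<in> E\<close>, so the image of \<open>U\<close> under \<open>rep E\<close> has one
    realization per type over \<open>E\<close> and is no larger than the number of these
    types.\<close>
  define rep where "rep E x = (SOME y. y \<in> U \<and> (\<forall>b \<in> E. T y b = T x b))" for E x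
  have rep: "rep E x \<in> U \<and> (\<forall>b \<in> E. T (rep E x) b = T x b)" if "x \<in> U" for E x
    unfolding rep_def by (rule someI[of _ x]) (use that in simp)
  define G where "G S = (\<Union>J \<in> JJ. \<Union>E \<in> {E. E \<subseteq> seqs J S \<and> |E| \<le>o \<theta>}. rep E ` U)" for S
  have G: "G S \<subseteq> U \<and> |G S| \<le>o exp2 \<theta>" if S: "S \<subseteq> U" "|S| \<le>o \<theta>" for S
  proof
    show "G S \<subseteq> U" unfolding G_def using rep by blast
    have "|rep E ` U| \<le>o exp2 \<theta>" if JE: "J \<in> JJ" "E \<subseteq> seqs J S" "|E| \<le>o \<theta>" for J E
    proof (rule card_of_image_family[OF th JE(3), where h = "\<lambda>b x. T x b"])
      fix b assume "b \<in> E"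
      then have "b \<in> seqs J U" using JE(2) seqs_mono[OF S(1)] by blast
      then have "(\<lambda>x. T x b) ` U \<subseteq> (\<lambda>(x, b). T x b) ` (U \<times> seqs J U)" by force
      then show "|(\<lambda>x. T x b) ` U| \<le>o exp2 \<theta>"
        by (rule ordLeq_transitive[OF card_of_mono1 types[OF JE(1)]])
    next
      fix x y assume "\<And>b. b \<in> E \<Longrightarrow> T x b = T y b"
      then show "rep E x = rep E y" unfolding rep_def by (metis (mono_tags, lifting))
    qed
    then have "|\<Union>E \<in> {E. E \<subseteq> seqs J S \<and> |E| \<le>o \<theta>}. rep E ` U| \<le>o exp2 \<theta>"
      if "J \<in> JJ" for J
      using that card_of_subsets_exp2[OF th card_of_seqs[OF th J[OF that] le_th[OF S(2)]]]
      by (intro UNION_Cinfinite_bound[OF _ _ inf]) auto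
    then show "|G S| \<le>o exp2 \<theta>"
      unfolding G_def using le_th[OF JJ] by (intro UNION_Cinfinite_bound[OF _ _ inf]) auto
  qed
  obtain A' where A': "A \<subseteq> A'" "A' \<subseteq> U" "|A'| \<le>o exp2 \<theta>"
    and cl: "\<And>S. S \<subseteq> A' \<Longrightarrow> |S| \<le>o \<theta> \<Longrightarrow> G S \<subseteq> A'"
    using bounded_closure[OF th A, of G] G by blast
  have realize: "\<exists>y \<in> A'. \<forall>b \<in> E. T y b = T x b"
    if E: "J \<in> JJ" "E \<subseteq> seqs J A'" "|E| \<le>o \<theta>" and x: "x \<in> U" for J E x
  proof -
    \<comment> \<open>Closure under \<open>G\<close> speaks of small subsets of \<open>A'\<close>,
      not of small families of sequences. At most \<open>\<theta>\<close> sequences, each with at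
      most \<open>\<theta>\<close> entries, use only \<open>\<theta>\<close> elements.\<close>
    let ?S = "\<Union>b \<in> E. ran b"
    have "|ran b| \<le>o \<theta>" if "b \<in> E" for b
    proof -
      have "dom b = J" using that E(2) by (auto simp: seqs_def)
      then show ?thesis
        unfolding ran_eq_image_dom using ordLeq_transitive[OF card_of_image J[OF E(1)]] by simp
    qed
    then have "|?S| \<le>o \<theta>"
      using E(3) by (intro UNION_Cinfinite_bound[OF _ _ th]) auto
    moreover have "?S \<subseteq> A'" using E(2) by (auto simp: seqs_def)
    ultimately have "G ?S \<subseteq> A'" by (rule cl[rotated])
    moreover have "E \<subseteq> seqs J ?S" using E(2) by (auto simp: seqs_def)
    then have "rep E x \<in> G ?S" unfolding G_def using E x by blast
    ultimately show ?thesis using rep[OF x] by blast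
  qed
  \<comment> \<open>A pointwise form of nonsplitting: \<open>b\<close> and \<open>c\<close> are
    compared through one element of \<open>B\<close> at a time rather than through their full types
    over \<open>B\<close>. This suits the order property, which sees one \<open>x i\<close> and one
    pair \<open>b j\<close>, \<open>c j\<close> together.\<close>
  define nonsplit where "nonsplit J x B \<longleftrightarrow> (\<forall>b \<in> seqs J A'. \<forall>c \<in> seqs J A'.
    (\<forall>y \<in> B. T y b = T y c) \<longrightarrow> T x b = T x c)" for J x B
  have ex_nonsplit: "\<exists>B \<subseteq> A'. |B| <o \<chi> \<and> nonsplit J x B" if Jx: "J \<in> JJ" "x \<in> U" for J x
  proof (rule ccontr)
    assume "\<not> ?thesis"
    then have split: "\<exists>b \<in> seqs J A'. \<exists>c \<in> seqs J A'. (\<forall>y \<in> B. T y b = T y c) \<and> T x b \<noteq> T x c"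
      if "B \<subseteq> A'" "|B| <o \<chi>" for B
      using that unfolding nonsplit_def by blast
    have wf: "wf (\<chi> - Id)"
      using ch card_order_on_well_order_on by (intro wo_rel.WF) (auto simp: wo_rel_def)
    \<comment> \<open>At stage \<open>i\<close>, \<open>b\<close> and \<open>c\<close> witness that
      \<open>x\<close> splits over the elements chosen before, and \<open>y\<close> imitates
      \<open>x\<close> on all earlier \<open>b\<close> and \<open>c\<close>. So a later
      \<open>y\<close> separates an earlier pair just as \<open>x\<close> does, while an earlier
      \<open>y\<close> does not separate a later pair. Nothing is demanded of \<open>y\<close> on
      its own pair.\<close>
    let ?P = "\<lambda>f i (y, b, c). i \<in> Field \<chi> \<longrightarrow> y \<in> A' \<and> b \<in> seqs J A' \<and> c \<in> seqs J A' \<and>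
      T x b \<noteq> T x c \<and> (\<forall>j. (j, i) \<in> \<chi> - Id \<longrightarrow> T (fst (f j)) b = T (fst (f j)) c \<and>
        T y (fst (snd (f j))) = T x (fst (snd (f j))) \<and>
        T y (snd (snd (f j))) = T x (snd (snd (f j))))"
    have "\<exists>f. \<forall>i. ?P f i (f i)"
    proof (rule dependent_wf_choice[OF wf])
      fix f g :: "'c \<Rightarrow> 'u \<times> ('i \<rightharpoonup> 'u) \<times> ('i \<rightharpoonup> 'u)" and i r
      assume "\<And>j. (j, i) \<in> \<chi> - Id \<Longrightarrow> f j = g j"
      then show "?P f i r = ?P g i r" by (cases r) force
    next
      fix i and f :: "'c \<Rightarrow> 'u \<times> ('i \<rightharpoonup> 'u) \<times> ('i \<rightharpoonup> 'u)"
      assume prev: "\<And>j. (j, i) \<in> \<chi> - Id \<Longrightarrow> ?P f j (f j)"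
      show "\<exists>r. ?P f i r"
      proof (cases "i \<in> Field \<chi>")
        case True
        let ?I = "{j. (j, i) \<in> \<chi> - Id}"
        have "?I = underS \<chi> i" by (auto simp: underS_def)
        then have I: "|?I| <o \<chi>" using card_of_underS[OF ch(1) True] by simp
        have prev': "fst (f j) \<in> A' \<and> fst (snd (f j)) \<in> seqs J A' \<and> snd (snd (f j)) \<in> seqs J A'"
          if "j \<in> ?I" for j
          using prev[of j] that FieldI1[of j i \<chi>] by (cases "f j") auto
        have "|(\<lambda>j. fst (f j)) ` ?I| <o \<chi>" by (rule ordLeq_ordLess_trans[OF card_of_image I])
        then obtain b c where bc: "b \<in> seqs J A'" "c \<in> seqs J A'" "T x b \<noteq> T x c"
          "\<forall>j \<in> ?I. T (fst (f j)) b = T (fst (f j)) c"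
          using split[of "(\<lambda>j. fst (f j)) ` ?I"] prev' by blast
        let ?E = "(\<lambda>j. fst (snd (f j))) ` ?I \<union> (\<lambda>j. snd (snd (f j))) ` ?I"
        have "|?I| \<le>o \<theta>"
          by (rule ordLeq_transitive[OF ordLess_imp_ordLeq[OF I] ch(2)])
        then have "|?E| \<le>o \<theta>"
          by (intro Un_Cinfinite_bound[OF _ _ th] ordLeq_transitive[OF card_of_image])
        moreover have "?E \<subseteq> seqs J A'" using prev' by blast
        ultimately have "\<exists>y \<in> A'. \<forall>b \<in> ?E. T y b = T x b"
          by (intro realize[OF Jx(1) _ _ Jx(2)])
        then obtain y where "y \<in> A'" "\<forall>b \<in> ?E. T y b = T x b" by (elim bexE)
        then show ?thesis using bc by (intro exI[of _ "(y, b, c)"]) auto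
      qed auto
    qed
    then obtain f where f: "\<And>i. ?P f i (f i)" by blast
    show False
    proof (rule no_order[OF Jx(1), of "\<lambda>i. fst (f i)" "\<lambda>i. fst (snd (f i))" "\<lambda>i. snd (snd (f i))"])
      fix i assume "i \<in> Field \<chi>"
      then show "fst (f i) \<in> U \<and> fst (snd (f i)) \<in> seqs J U \<and> snd (snd (f i)) \<in> seqs J U"
        using f[of i] A'(2) seqs_mono[OF A'(2), of J] by (cases "f i") auto
    next
      fix i j assume ij: "(i, j) \<in> \<chi>" "i \<noteq> j"
      then have F: "i \<in> Field \<chi>" "j \<in> Field \<chi>" by (auto simp: Field_def)
      show "T (fst (f i)) (fst (snd (f j))) = T (fst (f i)) (snd (snd (f j))) \<and>
        T (fst (f j)) (fst (snd (f i))) \<noteq> T (fst (f j)) (snd (snd (f i)))"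
        using f[of i] f[of j] ij F by (cases "f i"; cases "f j") auto
    qed
  qed
  have bound: "|(\<lambda>x. restrict (T x) (seqs J A')) ` U| \<le>o exp2 \<theta>" if JJ': "J \<in> JJ" for J
  proof -
    let ?BB = "{B. B \<subseteq> A' \<and> |B| <o \<chi>}"
    let ?f = "\<lambda>x. restrict (T x) (seqs J A')"
    have "?BB \<subseteq> {B. B \<subseteq> A' \<and> |B| \<le>o \<theta>}"
      by (auto intro: ordLeq_transitive[OF ordLess_imp_ordLeq ch(2)])
    then have BB: "|?BB| \<le>o exp2 \<theta>"
      by (rule ordLeq_transitive[OF card_of_mono1 card_of_subsets_exp2[OF th A'(3)]])
    have each: "|?f ` {x \<in> U. nonsplit J x B}| \<le>o exp2 \<theta>" if B: "B \<subseteq> A'" "|B| <o \<chi>" for B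
    proof -
      \<comment> \<open>\<open>q b\<close> is the class of \<open>b\<close> as seen from
        \<open>B\<close>, and \<open>s\<close> chooses a representative of each class. If
        \<open>x\<close> does not split over \<open>B\<close>, its values on the representatives
        determine all of \<open>T x\<close> on \<open>seqs J A'\<close>, and there are at most
        \<open>\<theta>\<close> classes.\<close>
      define q where "q b = restrict (\<lambda>y. T y b) B" for b
      define s where "s z = (SOME b. b \<in> seqs J A' \<and> q b = z)" for z
      have s: "s (q b) \<in> seqs J A' \<and> q (s (q b)) = q b" if "b \<in> seqs J A'" for b
        unfolding s_def by (rule someI[of _ b]) (use that in simp)
      have sub: "q ` seqs J A' \<subseteq> q ` seqs J U" using seqs_mono[OF A'(2)] by blast
      have "|q ` seqs J A'| \<le>o \<theta>"
        by (rule ordLeq_transitive[OF card_of_mono1[OF sub]])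
          (use classes[OF JJ' _ B(2)] B(1) A'(2) in \<open>simp add: q_def[abs_def]\<close>)
      then show ?thesis
      proof (rule card_of_image_family[OF th, where h = "\<lambda>z x. T x (s z)"])
        fix z assume "z \<in> q ` seqs J A'"
        then have "s z \<in> seqs J U" using s seqs_mono[OF A'(2)] by blast
        then have "(\<lambda>x. T x (s z)) ` {x \<in> U. nonsplit J x B} \<subseteq>
            (\<lambda>(x, b). T x b) ` (U \<times> seqs J U)" by force
        then show "|(\<lambda>x. T x (s z)) ` {x \<in> U. nonsplit J x B}| \<le>o exp2 \<theta>"
          by (rule ordLeq_transitive[OF card_of_mono1 types[OF JJ']])
      next
        fix x y assume x: "x \<in> {x \<in> U. nonsplit J x B}" and y: "y \<in> {x \<in> U. nonsplit J x B}"
          and eq: "\<And>z. z \<in> q ` seqs J A' \<Longrightarrow> T x (s z) = T y (s z)"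
        have "T x b = T y b" if b: "b \<in> seqs J A'" for b
        proof -
          have "\<forall>w \<in> B. T w b = T w (s (q b))"
            using s[OF b] unfolding q_def by (metis restrict_apply')
          then have "T x b = T x (s (q b))" "T y b = T y (s (q b))"
            using x y b s[OF b] unfolding nonsplit_def by blast+
          then show ?thesis using eq b by simp
        qed
        then show "?f x = ?f y" by (auto simp: restrict_def)
      qed
    qed
    have "?f ` U = (\<Union>B \<in> ?BB. ?f ` {x \<in> U. nonsplit J x B})"
      using ex_nonsplit[OF JJ'] by blast
    also have "|\<dots>| \<le>o exp2 \<theta>"
      by (rule UNION_Cinfinite_bound[OF BB _ inf]) (use each in blast)
    finally show ?thesis .
  qed
  show ?thesis
  proof (rule card_of_image_family[OF th JJ bound])
    fix x y
    assume eq: "\<And>J. J \<in> JJ \<Longrightarrow> restrict (T x) (seqs J A') = restrict (T y) (seqs J A')"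
    have "T x b = T y b" if "J \<in> JJ" "b \<in> seqs J A" for J b
      using eq[OF that(1)] that(2) seqs_mono[OF A'(1)] by (metis restrict_apply' subsetD)
    then show "restrict (T x) (\<Union>J \<in> JJ. seqs J A) = restrict (T y) (\<Union>J \<in> JJ. seqs J A)"
      by (intro restrict_ext) blast
  qed
qed

section \<open>Isomorphic copies and Galois types over the range of a sequence\<close>

lemma map_option_eq_iff:
  assumes "inj_on f C" "ran u \<subseteq> C"
  shows "map_option f (u i) = map_option f (u j) \<longleftrightarrow> u i = u j"
  using assms by (cases "u i"; cases "u j") (auto simp: ran_def inj_on_def subset_eq)

lemma map_option_comp_ident:
  assumes "\<And>x. x \<in> ran u \<Longrightarrow> f x = g x"
  shows "map_option f \<circ> u = map_option g \<circ> u"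
proof
  fix i show "(map_option f \<circ> u) i = (map_option g \<circ> u) i"
    using assms by (cases "u i") (auto simp: ran_def)
qed

lemma map_option_comp_map_comp: "map_option f \<circ> (u \<circ>\<^sub>m r) = (map_option f \<circ> u) \<circ>\<^sub>m r"
  by (auto simp: map_comp_def fun_eq_iff split: option.splits)

lemma ran_map_comp: "ran (u \<circ>\<^sub>m r) \<subseteq> ran u"
  by (auto simp: map_comp_def ran_def split: option.splits)

lemma ran_map_option_comp: "ran (map_option f \<circ> u) = f ` ran u"
  by (force simp: ran_def image_def)

text \<open>Interpretations are transported back and forth along \<open>h\<close>. The default
  values outside the vocabulary and the new universe are those that \<open>is_struct\<close>
  prescribes.\<close>

definition image_struct ::
  "('f, 'r) vocabulary \<Rightarrow> ('u \<Rightarrow> 'u) \<Rightarrow> ('u, 'f, 'r) fo_struct \<Rightarrow> ('u, 'f, 'r) fo_struct" where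
  "image_struct \<tau> h M =
     \<lparr>carrier = h ` carrier M,
      fun_in = \<lambda>F ys. if F \<in> fun_syms \<tau> \<and> ys \<in> tuples (h ` carrier M) (fun_ar \<tau> F)
        then h (fun_in M F (map (inv_into (carrier M) h) ys)) else undefined,
      rel_in = \<lambda>R. if R \<in> rel_syms \<tau> then map h ` rel_in M R else {}\<rparr>"

lemma tuples_map: "f ` A \<subseteq> B \<Longrightarrow> xs \<in> tuples A n \<Longrightarrow> map f xs \<in> tuples B n"
  by (auto simp: tuples_def)

lemma map_inv_into_map:
  "inj_on h A \<Longrightarrow> set xs \<subseteq> A \<Longrightarrow> map (inv_into A h) (map h xs) = xs"
  by (induction xs) auto

lemma map_map_inv_into:
  "set ys \<subseteq> h ` A \<Longrightarrow> map h (map (inv_into A h) ys) = ys"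
  by (induction ys) (auto simp: f_inv_into_f)

lemma is_struct_image_struct:
  assumes M: "is_struct \<tau> M" and h: "inj_on h (carrier M)"
  shows "is_struct \<tau> (image_struct \<tau> h M)"
proof -
  have inv: "map (inv_into (carrier M) h) ys \<in> tuples (carrier M) n"
    if "ys \<in> tuples (h ` carrier M) n" for ys n
    using that by (auto simp: tuples_def inv_into_into)
  have "small |h ` carrier M|"
    using M ordLeq_ordLess_trans[OF card_of_image] unfolding is_struct_def small_def by blast
  moreover have "h (fun_in M F (map (inv_into (carrier M) h) ys)) \<in> h ` carrier M"
    if "F \<in> fun_syms \<tau>" "ys \<in> tuples (h ` carrier M) (fun_ar \<tau> F)" for F ys
    using M inv[OF that(2)] that(1) unfolding is_struct_def by blast
  moreover have "map h ` rel_in M R \<subseteq> tuples (h ` carrier M) (rel_ar \<tau> R)"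
    if "R \<in> rel_syms \<tau>" for R
    using M that tuples_map[of h "carrier M" "h ` carrier M"] unfolding is_struct_def by blast
  ultimately show ?thesis
    using M unfolding is_struct_def image_struct_def by simp
qed

lemma is_iso_image_struct:
  assumes M: "is_struct \<tau> M" and h: "inj_on h (carrier M)"
  shows "is_iso \<tau> h M (image_struct \<tau> h M)"
proof -
  have "map h xs \<in> map h ` rel_in M R \<longleftrightarrow> xs \<in> rel_in M R"
    if R: "R \<in> rel_syms \<tau>" and xs: "xs \<in> tuples (carrier M) (rel_ar \<tau> R)" for R xs
  proof
    assume "map h xs \<in> map h ` rel_in M R"
    then obtain ys where ys: "ys \<in> rel_in M R" "map h xs = map h ys" by blast
    then have "ys \<in> tuples (carrier M) (rel_ar \<tau> R)" using M R unfolding is_struct_def by blast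
    then have "xs = ys"
      using xs ys(2) map_inv_into_map[OF h] by (metis (mono_tags, lifting) mem_Collect_eq tuples_def)
    then show "xs \<in> rel_in M R" using ys by simp
  qed simp
  moreover have "map (inv_into (carrier M) h) (map h xs) = xs" if "xs \<in> tuples (carrier M) n" for xs n
    using map_inv_into_map[OF h] that by (simp add: tuples_def)
  ultimately show ?thesis
    using h tuples_map[of h "carrier M" "h ` carrier M"]
    unfolding is_iso_def image_struct_def by (simp add: bij_betw_def del: map_map)
qed

lemma is_iso_id: "is_iso \<tau> id M M"
  by (simp add: is_iso_def)

lemma is_iso_comp:
  assumes f: "is_iso \<tau> f M N" and g: "is_iso \<tau> g N P"
  shows "is_iso \<tau> (g \<circ> f) M P"
proof -
  have im: "map f xs \<in> tuples (carrier N) n" if "xs \<in> tuples (carrier M) n" for xs n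
    using f that by (intro tuples_map) (auto simp: is_iso_def bij_betw_def)
  show ?thesis
    using f g im bij_betw_trans[of f "carrier M" "carrier N" g "carrier P"]
    unfolding is_iso_def by simp
qed

lemma is_iso_inv_into:
  assumes M: "is_struct \<tau> M" and f: "is_iso \<tau> f M N"
  shows "is_iso \<tau> (inv_into (carrier M) f) N M"
proof -
  let ?g = "inv_into (carrier M) f"
  have bij: "bij_betw f (carrier M) (carrier N)" using f by (simp add: is_iso_def)
  have g: "map ?g ys \<in> tuples (carrier M) n \<and> map f (map ?g ys) = ys"
    if "ys \<in> tuples (carrier N) n" for ys n
    using that bij map_map_inv_into[of ys f "carrier M"]
    by (auto simp: tuples_def bij_betw_def inv_into_into simp del: map_map)
  have "?g (fun_in N F ys) = fun_in M F (map ?g ys)"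
    if F: "F \<in> fun_syms \<tau>" and ys: "ys \<in> tuples (carrier N) (fun_ar \<tau> F)" for F ys
  proof -
    have "f (fun_in M F (map ?g ys)) = fun_in N F ys"
      using f F g[OF ys] unfolding is_iso_def by metis
    moreover have "fun_in M F (map ?g ys) \<in> carrier M"
      using M F g[OF ys] unfolding is_struct_def by blast
    ultimately show ?thesis
      using bij by (metis bij_betw_inv_into_left)
  qed
  moreover have "ys \<in> rel_in N R \<longleftrightarrow> map ?g ys \<in> rel_in M R"
    if "R \<in> rel_syms \<tau>" "ys \<in> tuples (carrier N) (rel_ar \<tau> R)" for R ys
    using f that g[OF that(2)] unfolding is_iso_def by metis
  ultimately show ?thesis
    using bij_betw_inv_into[OF bij] unfolding is_iso_def by blast
qed

text \<open>Supplies the substructure premise of \<open>iso_strong\<close> when a strong extension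
  is copied along an isomorphism of the larger model.\<close>

lemma substruct_image_struct:
  assumes N: "is_struct \<tau> N" and sub: "substruct \<tau> N L" and h: "is_iso \<tau> h L Q"
  shows "substruct \<tau> (image_struct \<tau> h N) Q"
proof -
  have NL: "carrier N \<subseteq> carrier L" using sub by (simp add: substruct_def)
  have inj: "inj_on h (carrier N)"
    using h NL by (auto simp: is_iso_def bij_betw_def intro: inj_on_subset)
  have iso: "is_iso \<tau> h N (image_struct \<tau> h N)" by (rule is_iso_image_struct[OF N inj])
  have c: "carrier (image_struct \<tau> h N) = h ` carrier N" by (simp add: image_struct_def)
  have pre: "\<exists>xs \<in> tuples (carrier N) n. ys = map h xs" if "ys \<in> tuples (h ` carrier N) n" for ys n
    using that map_map_inv_into[of ys h "carrier N"]
    by (intro bexI[of _ "map (inv_into (carrier N) h) ys"])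
      (auto simp: tuples_def inv_into_into simp del: map_map)
  have L: "xs \<in> tuples (carrier L) n" if "xs \<in> tuples (carrier N) n" for xs n
    using that NL by (auto simp: tuples_def)
  have "h ` carrier N \<subseteq> carrier Q" using h NL by (auto simp: is_iso_def bij_betw_def)
  moreover have "fun_in (image_struct \<tau> h N) F ys = fun_in Q F ys"
    if F: "F \<in> fun_syms \<tau>" and ys: "ys \<in> tuples (h ` carrier N) (fun_ar \<tau> F)" for F ys
  proof -
    obtain xs where xs: "xs \<in> tuples (carrier N) (fun_ar \<tau> F)" "ys = map h xs" using pre[OF ys] by blast
    have "fun_in (image_struct \<tau> h N) F ys = h (fun_in N F xs)"
      using iso F xs by (simp add: is_iso_def)
    also have "\<dots> = h (fun_in L F xs)" using sub F xs by (simp add: substruct_def)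
    also have "\<dots> = fun_in Q F ys" using h F xs L by (simp add: is_iso_def)
    finally show ?thesis .
  qed
  moreover have "ys \<in> rel_in (image_struct \<tau> h N) R \<longleftrightarrow> ys \<in> rel_in Q R"
    if R: "R \<in> rel_syms \<tau>" and ys: "ys \<in> tuples (h ` carrier N) (rel_ar \<tau> R)" for R ys
  proof -
    obtain xs where xs: "xs \<in> tuples (carrier N) (rel_ar \<tau> R)" "ys = map h xs" using pre[OF ys] by blast
    have "ys \<in> rel_in (image_struct \<tau> h N) R \<longleftrightarrow> xs \<in> rel_in N R"
      using iso R xs by (simp add: is_iso_def)
    also have "\<dots> \<longleftrightarrow> xs \<in> rel_in L R" using sub R xs by (simp add: substruct_def)
    also have "\<dots> \<longleftrightarrow> ys \<in> rel_in Q R" using h R xs L by (simp add: is_iso_def)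
    finally show ?thesis .
  qed
  ultimately show ?thesis unfolding substruct_def c by blast
qed

text \<open>Equal patterns of repetition make the assignment of \<open>b i\<close> to
  \<open>d i\<close> well defined and injective. The remaining elements of \<open>C\<close> are sent
  outside \<open>ran b\<close>; there is room, since removing a small set from the infinite type
  \<open>'u\<close> does not lower its cardinality.\<close>

lemma ex_inj_extension:
  fixes d b :: "'i \<rightharpoonup> 'u"
  assumes inf: "infinite (UNIV :: 'u set)" and small: "small |C|" "small |ran b|"
    and d: "ran d \<subseteq> C" "dom d = dom b" "\<And>i j. d i = d j \<longleftrightarrow> b i = b j"
  shows "\<exists>h. inj_on h C \<and> map_option h \<circ> d = b"
proof -
  have "|UNIV :: 'u set| \<le>o |UNIV - ran b|"
  proof (rule ccontr)
    assume "\<not> ?thesis"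
    then have "|UNIV - ran b| <o |UNIV :: 'u set|"
      using not_ordLeq_iff_ordLess card_of_Well_order by blast
    then have "|(UNIV - ran b) \<union> ran b| <o |UNIV :: 'u set|"
      using inf small(2) by (intro card_of_Un_ordLess_infinite) (auto simp: small_def)
    then show False by (simp add: ordLess_irreflexive)
  qed
  then have "|C - ran d| \<le>o |UNIV - ran b|"
    using small(1) unfolding small_def
    by (meson Diff_subset card_of_mono1 ordLeq_transitive ordLess_imp_ordLeq)
  then obtain k where k: "inj_on k (C - ran d)" "k ` (C - ran d) \<subseteq> UNIV - ran b"
    unfolding card_of_ordLeq[symmetric] by blast
  \<comment> \<open>The part of the renaming on \<open>ran d\<close>; the choice of \<open>i\<close>
    does not matter because \<open>b\<close> repeats entries exactly where \<open>d\<close>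
    does.\<close>
  define s where "s y = the (b (SOME i. d i = Some y))" for y
  have s: "b i = Some (s y)" if "d i = Some y" for i y
  proof -
    have "d (SOME i. d i = Some y) = Some y" by (rule someI[of _ i]) (rule that)
    then have "b (SOME i. d i = Some y) = b i" using d(3) that by metis
    moreover have "i \<in> dom b" using d(2) that by blast
    ultimately show ?thesis unfolding s_def by auto
  qed
  define h where "h y = (if y \<in> ran d then s y else k y)" for y
  have "map_option h (d i) = b i" for i
  proof (cases "d i")
    case None
    then have "b i = None" using d(2) by blast
    then show ?thesis using None by simp
  next
    case (Some y)
    then show ?thesis using s[OF Some] by (simp add: h_def ranI)
  qed
  then have "map_option h \<circ> d = b" by auto
  moreover have "inj_on h C"
  proof (rule inj_onI)
    fix x y assume xy: "x \<in> C" "y \<in> C" "h x = h y"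
    have sr: "s y \<in> ran b" if "y \<in> ran d" for y
      using that s by (auto simp: ran_def)
    have s_inj: "x = y" if xy: "x \<in> ran d" "y \<in> ran d" "s x = s y" for x y
    proof -
      obtain i j where ij: "d i = Some x" "d j = Some y" using xy by (auto simp: ran_def)
      then have "b i = b j" using s xy(3) by metis
      then have "d i = d j" using d(3) by simp
      then show ?thesis using ij by simp
    qed
    have k_ran: "k z \<notin> ran b" if "z \<in> C" "z \<notin> ran d" for z
      using k(2) that by blast
    show "x = y"
    proof (cases "x \<in> ran d"; cases "y \<in> ran d")
      assume "x \<notin> ran d" "y \<notin> ran d"
      then show ?thesis using xy k(1) by (simp add: h_def inj_on_def)
    qed (use xy sr s_inj k_ran in \<open>auto simp: h_def, metis+\<close>)
  qed
  ultimately show ?thesis by blast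
qed

section \<open>Reindexing sequences and moving K-embeddings along isomorphisms\<close>

context AEC
begin

lemma gal_step_reindex:
  assumes "((a, A, M), (b, B, N)) \<in> gal_step K"
  shows "((a \<circ>\<^sub>m r, A, M), (b \<circ>\<^sub>m r, B, N)) \<in> gal_step K"
proof -
  have "ran (a \<circ>\<^sub>m r) \<subseteq> carrier M \<and> ran (b \<circ>\<^sub>m r) \<subseteq> carrier N"
    using assms ran_map_comp[of a r] ran_map_comp[of b r] unfolding gal_step_iff by auto
  moreover obtain L f g where "L \<in> models K" "K_embedding K f M L" "K_embedding K g N L"
    "\<forall>x \<in> A. f x = x \<and> g x = x" "map_option f \<circ> a = map_option g \<circ> b"
    using assms unfolding gal_step_iff by blast
  moreover from this have "map_option f \<circ> (a \<circ>\<^sub>m r) = map_option g \<circ> (b \<circ>\<^sub>m r)"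
    unfolding map_option_comp_map_comp by simp
  ultimately show ?thesis
    using assms unfolding gal_step_iff by blast
qed

text \<open>Composition with a partial map \<open>r\<close> covers subsequences, permutations and
  repetitions of entries; the embeddings in each link of the chain stay the same.\<close>

lemma gtp_reindex:
  assumes "M \<in> models K" "A \<subseteq> carrier M" "ran a \<subseteq> carrier M"
    and "N \<in> models K" "B \<subseteq> carrier N" "ran b \<subseteq> carrier N"
    and eq: "gtp K a A M = gtp K b B N"
  shows "gtp K (a \<circ>\<^sub>m r) A M = gtp K (b \<circ>\<^sub>m r) B N"
proof -
  have "((a \<circ>\<^sub>m r, A, M), (fst t \<circ>\<^sub>m r, snd t)) \<in> (gal_step K)\<^sup>+"
    if "((a, A, M), t) \<in> (gal_step K)\<^sup>+" for t
    using that
  proof (induction rule: trancl_induct)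
    case (base t)
    obtain b B N where t: "t = (b, B, N)" by (cases t)
    show ?case
      using r_into_trancl[OF gal_step_reindex[OF base[unfolded t]]] unfolding t by simp
  next
    case (step t u)
    obtain b B N where t: "t = (b, B, N)" by (cases t)
    obtain c C P where u: "u = (c, C, P)" by (cases u)
    show ?case
      using trancl_into_trancl[OF _ gal_step_reindex[OF step.hyps(2)[unfolded t u]]] step.IH
      unfolding t u by simp
  qed
  from this[of "(b, B, N)"] show ?thesis
    using gtp_eqI gtp_eq_iff[OF assms(1-6)] eq by simp
qed

lemma K_embedding_props:
  assumes "K_embedding K f M N"
  shows "inj_on f (carrier M)" "f ` carrier M \<subseteq> carrier N"
proof -
  obtain N0 where "is_iso (vocab K) f M N0" and "strong K N0 N"
    using assms unfolding K_embedding_def by blast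
  moreover from \<open>strong K N0 N\<close> have "carrier N0 \<subseteq> carrier N"
    using strong_substruct[of N0 N] by (simp add: substruct_def)
  ultimately show "inj_on f (carrier M)" "f ` carrier M \<subseteq> carrier N"
    by (auto simp: is_iso_def bij_betw_def)
qed

lemma K_embedding_iso: "is_iso (vocab K) f M N \<Longrightarrow> N \<in> models K \<Longrightarrow> K_embedding K f M N"
  unfolding K_embedding_def using strong_refl[of N] by blast

lemma K_embedding_strong: "strong K M N \<Longrightarrow> K_embedding K id M N"
  unfolding K_embedding_def using strong_models[of M N] is_iso_id[of "vocab K" M] by blast

lemma K_embedding_comp_iso:
  "is_iso (vocab K) f M N \<Longrightarrow> K_embedding K g N L \<Longrightarrow> K_embedding K (g \<circ> f) M L"
  unfolding K_embedding_def using is_iso_comp[of "vocab K" f M N g] by blast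

lemma iso_comp_K_embedding:
  assumes f: "K_embedding K f M L" and h: "is_iso (vocab K) h L Q" and Q: "Q \<in> models K"
  shows "K_embedding K (h \<circ> f) M Q"
proof -
  obtain N where N: "N \<in> models K" "is_iso (vocab K) f M N" "strong K N L"
    using f unfolding K_embedding_def by blast
  let ?N = "image_struct (vocab K) h N"
  have sN: "is_struct (vocab K) N" and sQ: "is_struct (vocab K) Q"
    by (rule models_struct[OF N(1)], rule models_struct[OF Q])
  have sub: "substruct (vocab K) N L" by (rule strong_substruct[OF N(3)])
  have inj: "inj_on h (carrier N)"
    using h sub by (auto simp: is_iso_def bij_betw_def substruct_def intro: inj_on_subset)
  have iso: "is_iso (vocab K) h N ?N" by (rule is_iso_image_struct[OF sN inj])
  have "strong K ?N Q"
    by (rule iso_strong[OF N(3) is_struct_image_struct[OF sN inj] sQ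
          substruct_image_struct[OF sN sub h] h iso])
  moreover have "is_iso (vocab K) (h \<circ> f) M ?N" by (rule is_iso_comp[OF N(2) iso])
  ultimately show ?thesis unfolding K_embedding_def using strong_models[of ?N Q] by blast
qed

text \<open>Puts displaced parameters back in place: in the copy of \<open>N\<close> the sequence
  \<open>d\<close> has become \<open>b\<close> itself, so that types over \<open>ran b\<close> make
  sense there.\<close>

lemma ex_renaming:
  fixes d b :: "'i \<rightharpoonup> 'u"
  assumes inf: "infinite (UNIV :: 'u set)" and N: "N \<in> models K" and small: "small |ran b|"
    and d: "ran d \<subseteq> carrier N" "dom d = dom b" "\<And>i j. d i = d j \<longleftrightarrow> b i = b j"
  obtains P \<sigma> where "P \<in> models K" "is_iso (vocab K) \<sigma> N P" "map_option \<sigma> \<circ> d = b"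
proof -
  have sN: "is_struct (vocab K) N" by (rule models_struct[OF N])
  then have "small |carrier N|" by (simp add: is_struct_def)
  then obtain h where h: "inj_on h (carrier N)" "map_option h \<circ> d = b"
    using ex_inj_extension[OF inf _ small d] by blast
  have iso: "is_iso (vocab K) h N (image_struct (vocab K) h N)"
    by (rule is_iso_image_struct[OF sN h(1)])
  show thesis
    by (rule that[OF iso_models[OF N is_struct_image_struct[OF sN h(1)] iso] iso h(2)])
qed

text \<open>In the amalgam \<open>L\<close> the two subsequences picked out by \<open>r\<close> have
  a common image, with the same repetitions as \<open>b\<close>. Renaming \<open>L\<close> to
  \<open>Q\<close> by \<open>\<rho>\<close> turns this image into \<open>b\<close>; then
  \<open>f\<close> and \<open>g\<close>, conjugated by \<open>\<rho>\<close> and the maps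
  \<open>\<sigma>1\<close>, \<open>\<sigma>2\<close>, fix \<open>ran b\<close> pointwise.\<close>

lemma gal_step_over_range:
  fixes b :: "'i \<rightharpoonup> 'u" and e1 e2 :: "'k \<rightharpoonup> 'u"
  assumes inf: "infinite (UNIV :: 'u set)"
    and step: "((e1, {}, N1), (e2, {}, N2)) \<in> gal_step K"
    and P: "P1 \<in> models K" "P2 \<in> models K"
    and iso: "is_iso (vocab K) \<sigma>1 N1 P1" "is_iso (vocab K) \<sigma>2 N2 P2"
    and b: "map_option \<sigma>1 \<circ> (e1 \<circ>\<^sub>m r) = b" "map_option \<sigma>2 \<circ> (e2 \<circ>\<^sub>m r) = b"
  shows "((map_option \<sigma>1 \<circ> e1, ran b, P1), (map_option \<sigma>2 \<circ> e2, ran b, P2)) \<in> gal_step K"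
proof -
  have N: "N1 \<in> models K" "N2 \<in> models K" and e: "ran e1 \<subseteq> carrier N1" "ran e2 \<subseteq> carrier N2"
    using step unfolding gal_step_iff by auto
  obtain L f g where L: "L \<in> models K" and f: "K_embedding K f N1 L" and g: "K_embedding K g N2 L"
    and fg: "map_option f \<circ> e1 = map_option g \<circ> e2"
    using step unfolding gal_step_iff by blast
  have bij: "bij_betw \<sigma>1 (carrier N1) (carrier P1)" "bij_betw \<sigma>2 (carrier N2) (carrier P2)"
    using iso by (auto simp: is_iso_def)
  let ?d = "map_option f \<circ> (e1 \<circ>\<^sub>m r)"
  have d2: "?d = map_option g \<circ> (e2 \<circ>\<^sub>m r)" unfolding map_option_comp_map_comp fg ..
  have e': "ran (e1 \<circ>\<^sub>m r) \<subseteq> carrier N1" "ran (e2 \<circ>\<^sub>m r) \<subseteq> carrier N2"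
    by (rule subset_trans[OF ran_map_comp e(1)], rule subset_trans[OF ran_map_comp e(2)])
  have ran_b: "ran b \<subseteq> carrier P1" "ran b \<subseteq> carrier P2"
  proof -
    have "ran b = \<sigma>1 ` ran (e1 \<circ>\<^sub>m r)" by (simp flip: b(1) add: ran_map_option_comp)
    then show "ran b \<subseteq> carrier P1" using e'(1) bij(1) by (auto simp: bij_betw_def)
    have "ran b = \<sigma>2 ` ran (e2 \<circ>\<^sub>m r)" by (simp flip: b(2) add: ran_map_option_comp)
    then show "ran b \<subseteq> carrier P2" using e'(2) bij(2) by (auto simp: bij_betw_def)
  qed
  have small: "small |ran b|"
    using models_struct[OF P(1)] ran_b(1) ordLeq_ordLess_trans[OF card_of_mono1]
    unfolding is_struct_def small_def by blast
  have d_L: "ran ?d \<subseteq> carrier L"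
    using e' K_embedding_props(2)[OF f] by (auto simp: ran_map_option_comp)
  have d_dom: "dom ?d = dom b" unfolding b(1)[symmetric] by (auto simp: dom_def)
  have d_pat: "?d i = ?d j \<longleftrightarrow> b i = b j" for i j
    unfolding b(1)[symmetric] comp_apply
    using map_option_eq_iff[OF K_embedding_props(1)[OF f] e'(1)]
      map_option_eq_iff[OF bij_betw_imp_inj_on[OF bij(1)] e'(1)] by simp
  obtain Q \<rho> where Q: "Q \<in> models K" "is_iso (vocab K) \<rho> L Q" "map_option \<rho> \<circ> ?d = b"
    by (rule ex_renaming[OF inf L small d_L d_dom d_pat])
  have emb: "\<exists>k. K_embedding K k P Q \<and> (\<forall>z \<in> ran b. k z = z) \<and>
      map_option k \<circ> (map_option \<sigma> \<circ> e) = map_option \<rho> \<circ> (map_option h \<circ> e)"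
    if N: "N \<in> models K" and iso: "is_iso (vocab K) \<sigma> N P" and h: "K_embedding K h N L"
      and e: "ran e \<subseteq> carrier N" and b: "map_option \<sigma> \<circ> (e \<circ>\<^sub>m r) = b"
      and d: "?d = map_option h \<circ> (e \<circ>\<^sub>m r)"
    for N P \<sigma> h and e :: "'k \<rightharpoonup> 'u"
  proof -
    let ?k = "\<rho> \<circ> h \<circ> inv_into (carrier N) \<sigma>"
    have inj: "inj_on \<sigma> (carrier N)" using iso by (simp add: is_iso_def bij_betw_def)
    have k: "?k (\<sigma> x) = \<rho> (h x)" if "x \<in> carrier N" for x
      using that inj by simp
    have "K_embedding K ?k P Q"
      by (rule K_embedding_comp_iso[OF is_iso_inv_into[OF models_struct[OF N] iso]
            iso_comp_K_embedding[OF h Q(2) Q(1)]])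
    moreover have "?k z = z" if z: "z \<in> ran b" for z
    proof -
      obtain i where i: "b i = Some z" using z by (auto simp: ran_def)
      then obtain x where x: "(e \<circ>\<^sub>m r) i = Some x" "z = \<sigma> x"
        using fun_cong[OF b, of i] by auto
      have "b i = Some (\<rho> (h x))"
        using fun_cong[OF Q(3), of i] x(1) unfolding d by simp
      then have "\<rho> (h x) = z" using i by simp
      moreover have "x \<in> carrier N" using ranI[of "e \<circ>\<^sub>m r" i x] x(1) e ran_map_comp[of e r] by blast
      ultimately show ?thesis using k[of x] unfolding x(2) by metis
    qed
    moreover have "map_option (?k \<circ> \<sigma>) \<circ> e = map_option (\<rho> \<circ> h) \<circ> e"
      by (rule map_option_comp_ident) (use k e in auto)
    then have "map_option ?k \<circ> (map_option \<sigma> \<circ> e) = map_option \<rho> \<circ> (map_option h \<circ> e)"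
      by (simp add: fun_eq_iff option.map_comp)
    ultimately show ?thesis by blast
  qed
  obtain k1 where k1: "K_embedding K k1 P1 Q" "\<forall>z \<in> ran b. k1 z = z"
    "map_option k1 \<circ> (map_option \<sigma>1 \<circ> e1) = map_option \<rho> \<circ> (map_option f \<circ> e1)"
    using emb[OF N(1) iso(1) f e(1) b(1) refl] by blast
  obtain k2 where k2: "K_embedding K k2 P2 Q" "\<forall>z \<in> ran b. k2 z = z"
    "map_option k2 \<circ> (map_option \<sigma>2 \<circ> e2) = map_option \<rho> \<circ> (map_option g \<circ> e2)"
    using emb[OF N(2) iso(2) g e(2) b(2) d2] by blast
  have "ran (map_option \<sigma>1 \<circ> e1) \<subseteq> carrier P1" "ran (map_option \<sigma>2 \<circ> e2) \<subseteq> carrier P2"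
    using e bij unfolding ran_map_option_comp bij_betw_def by blast+
  moreover have "map_option k1 \<circ> (map_option \<sigma>1 \<circ> e1) = map_option k2 \<circ> (map_option \<sigma>2 \<circ> e2)"
    unfolding k1(3) k2(3) fg ..
  ultimately show ?thesis
    unfolding gal_step_iff using P ran_b Q(1) k1(1,2) k2(1,2) by blast
qed

text \<open>
  The chain witnessing \<open>gtp K e {} M = gtp K e' {} M\<close> moves the subsequence \<open>b\<close>.  Replacing every model
  and every amalgam by an isomorphic copy that puts this subsequence back in place gives a chain over
  \<open>ran b\<close>.
\<close>

lemma gtp_over_range:
  fixes e e' :: "'k \<rightharpoonup> 'u"
  assumes inf: "infinite (UNIV :: 'u set)" and M: "M \<in> models K"
    and e: "ran e \<subseteq> carrier M" "ran e' \<subseteq> carrier M"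
    and b: "e \<circ>\<^sub>m r = b" "e' \<circ>\<^sub>m r = b"
    and eq: "gtp K e {} M = gtp K e' {} M"
  shows "gtp K e (ran b) M = gtp K e' (ran b) M"
proof -
  have id: "map_option id \<circ> u = u" for u :: "'x \<rightharpoonup> 'u"
    by (simp add: option.map_id0)
  have ran_b: "ran b \<subseteq> carrier M"
    unfolding b(1)[symmetric] by (rule subset_trans[OF ran_map_comp e(1)])
  have small: "small |ran b|"
    using models_struct[OF M] ran_b ordLeq_ordLess_trans[OF card_of_mono1]
    unfolding is_struct_def small_def by blast
  \<comment> \<open>The claim covers every copy of the current model that puts the parameters at
    \<open>b\<close>. The induction step can therefore use whichever copy the renaming provides, and
    at the end of the chain the copy is taken to be \<open>M\<close> itself, with the
    identity.\<close>
  have "fst (snd t) = {} \<and> (\<forall>P \<sigma>. P \<in> models K \<longrightarrow> is_iso (vocab K) \<sigma> (snd (snd t)) P \<longrightarrow>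
      map_option \<sigma> \<circ> (fst t \<circ>\<^sub>m r) = b \<longrightarrow>
      ((e, ran b, M), (map_option \<sigma> \<circ> fst t, ran b, P)) \<in> (gal_step K)\<^sup>+)"
    if "((e, {}, M), t) \<in> (gal_step K)\<^sup>+" for t
    using that
  proof (induction rule: trancl_induct)
    case (base t)
    obtain e2 B N where t: "t = (e2, B, N)" by (cases t)
    have B: "B = {}" using base unfolding t gal_step_iff by blast
    have "((e, ran b, M), (map_option \<sigma> \<circ> e2, ran b, P)) \<in> (gal_step K)\<^sup>+"
      if P: "P \<in> models K" "is_iso (vocab K) \<sigma> N P" "map_option \<sigma> \<circ> (e2 \<circ>\<^sub>m r) = b" for P \<sigma>
      using gal_step_over_range[OF inf base[unfolded t B] M P(1) is_iso_id P(2) _ P(3)] b(1)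
      unfolding id by (intro r_into_trancl) simp
    then show ?case unfolding t B fst_conv snd_conv by blast
  next
    case (step t u)
    obtain e1 B1 N1 where t: "t = (e1, B1, N1)" by (cases t)
    obtain e2 B2 N2 where u: "u = (e2, B2, N2)" by (cases u)
    have B1: "B1 = {}" using step.IH t by simp
    have B2: "B2 = {}" using step.hyps(2) unfolding t u B1 gal_step_iff by blast
    note st = step.hyps(2)[unfolded t u B1 B2]
    have N: "N1 \<in> models K" and e1: "ran e1 \<subseteq> carrier N1" and e2: "ran e2 \<subseteq> carrier N2"
      using st unfolding gal_step_iff by blast+
    obtain L f g where f: "K_embedding K f N1 L" and g: "K_embedding K g N2 L"
      and fg: "map_option f \<circ> e1 = map_option g \<circ> e2"
      using st unfolding gal_step_iff by blast
    have "((e, ran b, M), (map_option \<sigma> \<circ> e2, ran b, P)) \<in> (gal_step K)\<^sup>+"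
      if P: "P \<in> models K" and iso: "is_iso (vocab K) \<sigma> N2 P"
        and \<sigma>: "map_option \<sigma> \<circ> (e2 \<circ>\<^sub>m r) = b" for P \<sigma>
    proof -
      let ?d1 = "e1 \<circ>\<^sub>m r" and ?d2 = "e2 \<circ>\<^sub>m r"
      have d: "ran ?d1 \<subseteq> carrier N1" "ran ?d2 \<subseteq> carrier N2"
        by (rule subset_trans[OF ran_map_comp e1], rule subset_trans[OF ran_map_comp e2])
      have fgd: "map_option f \<circ> ?d1 = map_option g \<circ> ?d2"
        unfolding map_option_comp_map_comp fg ..
      have \<sigma>_inj: "inj_on \<sigma> (carrier N2)" using iso by (simp add: is_iso_def bij_betw_def)
      \<comment> \<open>The pattern of repetitions is pulled back from \<open>b\<close> through
        \<open>N2\<close> and the amalgam to \<open>N1\<close>; this is what allows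
        \<open>N1\<close> to be renamed.\<close>
      have pat: "?d1 i = ?d1 j \<longleftrightarrow> b i = b j" for i j
      proof -
        have "?d1 i = ?d1 j \<longleftrightarrow> (map_option f \<circ> ?d1) i = (map_option f \<circ> ?d1) j"
          using map_option_eq_iff[OF K_embedding_props(1)[OF f] d(1)] by simp
        also have "\<dots> \<longleftrightarrow> ?d2 i = ?d2 j"
          unfolding fgd using map_option_eq_iff[OF K_embedding_props(1)[OF g] d(2)] by simp
        also have "\<dots> \<longleftrightarrow> b i = b j"
          unfolding \<sigma>[symmetric] using map_option_eq_iff[OF \<sigma>_inj d(2)] by simp
        finally show ?thesis .
      qed
      have "dom ?d1 = dom (map_option f \<circ> ?d1)" by (auto simp: dom_def)
      also have "\<dots> = dom b" unfolding fgd \<sigma>[symmetric] by (auto simp: dom_def)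
      finally have dom: "dom ?d1 = dom b" .
      obtain P1 \<sigma>1 where P1: "P1 \<in> models K" "is_iso (vocab K) \<sigma>1 N1 P1" "map_option \<sigma>1 \<circ> ?d1 = b"
        by (rule ex_renaming[OF inf N small d(1) dom pat])
      have "((e, ran b, M), (map_option \<sigma>1 \<circ> e1, ran b, P1)) \<in> (gal_step K)\<^sup>+"
        using step.IH P1 unfolding t fst_conv snd_conv by blast
      then show ?thesis
        using gal_step_over_range[OF inf st P1(1) P P1(2) iso P1(3) \<sigma>] by (rule trancl_into_trancl)
    qed
    then show ?case unfolding u B2 fst_conv snd_conv by blast
  qed
  from this[of "(e', {}, M)"] have "((e, ran b, M), (e', ran b, M)) \<in> (gal_step K)\<^sup>+"
    using gtp_eq_iff[OF M _ e(1) M _ e(2)] eq M b(2) is_iso_id[of "vocab K" M]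
      id[of e'] id[of "e' \<circ>\<^sub>m r"] by (simp del: comp_apply) metis
  then show ?thesis by (rule gtp_eqI)
qed

end

section \<open>The number of Galois types over the empty set\<close>

lemma card_of_lists_Cinfinite:
  fixes A :: "'a set"
  assumes r: "Cinfinite r" and A: "|A| \<le>o r"
  shows "|{xs. set xs \<subseteq> A}| \<le>o r"
proof -
  have "|{xs. set xs \<subseteq> A \<and> length xs = n}| \<le>o r" for n
  proof (induction n)
    case 0
    have "{xs. set xs \<subseteq> A \<and> length xs = 0} = {[]}" by auto
    moreover have "|{[] :: 'a list}| \<le>o r"
      using r by (intro Card_order_singl_ordLeq) (auto simp: cinfinite_def)
    ultimately show ?case by simp
  next
    case (Suc n)
    have "{xs. set xs \<subseteq> A \<and> length xs = Suc n} =
        (\<lambda>(x, xs). x # xs) ` (A \<times> {xs. set xs \<subseteq> A \<and> length xs = n})"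
      by (auto simp: length_Suc_conv)
    also have "|\<dots>| \<le>o |A \<times> {xs. set xs \<subseteq> A \<and> length xs = n}|" by (rule card_of_image)
    also have "|A \<times> {xs. set xs \<subseteq> A \<and> length xs = n}| \<le>o r"
      using r A Suc by (intro card_of_Times_ordLeq_infinite_Field) (auto simp: cinfinite_def)
    finally show ?case .
  qed
  then have "|\<Union>n. {xs. set xs \<subseteq> A \<and> length xs = n}| \<le>o r"
    using r natLeq_ordLeq_cinfinite[OF r]
    by (intro UNION_Cinfinite_bound[OF ordIso_ordLeq_trans[OF card_of_nat]]) auto
  moreover have "(\<Union>n. {xs. set xs \<subseteq> A \<and> length xs = n}) = {xs. set xs \<subseteq> A}" by auto
  ultimately show ?thesis by simp
qed

text \<open>\<open>A <+> B\<close> stays below an infinite cardinal, and being infinite it is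
  equinumerous with its square, into which \<open>A \<times> B\<close> embeds.\<close>

lemma card_of_Times_ordLess:
  assumes r: "Cinfinite r" and A: "|A| <o r" and B: "|B| <o r" "infinite B"
  shows "|A \<times> B| <o r"
proof -
  let ?P = "A <+> B"
  have P: "|?P| <o r" using r A B by (intro card_of_Plus_ordLess_infinite_Field) (auto simp: cinfinite_def)
  have "|A \<times> B| \<le>o |?P \<times> ?P|"
    by (rule card_of_ordLeqI[where f = "\<lambda>(a, b). (Inl a, Inr b)"]) (auto simp: inj_on_def)
  also have "|?P \<times> ?P| =o |?P|"
    by (rule card_of_Times_same_infinite) (use B(2) in simp)
  finally show ?thesis using P by (rule ordLeq_ordLess_trans)
qed

text \<open>With values coded as subsets of \<open>N\<close>, a function on \<open>B\<close> becomes
  a relation between \<open>B\<close> and \<open>N\<close>. Bounding the values by a power set gives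
  one power set of a product, the form that \<open>2^{<\<chi>}\<close> can bound when
  \<open>B\<close> and \<open>N\<close> are below \<open>\<chi>\<close>.\<close>

lemma card_of_restrict_image:
  assumes "\<And>y s. y \<in> B \<Longrightarrow> s \<in> S \<Longrightarrow> T y s \<in> V" and V: "|V| \<le>o |Pow N|"
  shows "|(\<lambda>s. restrict (\<lambda>y. T y s) B) ` S| \<le>o |Pow (B \<times> N)|"
proof -
  obtain v where v: "inj_on v V" "v ` V \<subseteq> Pow N"
    using V card_of_ordLeq[of V "Pow N"] by blast
  have "|(\<lambda>s. restrict (\<lambda>y. T y s) B) ` S| \<le>o |(\<lambda>s. {(y, n). y \<in> B \<and> n \<in> v (T y s)}) ` S|"
  proof (rule card_of_image_kernel)
    fix s t
    assume st: "s \<in> S" "t \<in> S"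
      and eq: "{(y, n). y \<in> B \<and> n \<in> v (T y s)} = {(y, n). y \<in> B \<and> n \<in> v (T y t)}"
    have "T y s = T y t" if y: "y \<in> B" for y
    proof -
      have "v (T y s) = v (T y t)" using eq y by (auto simp: set_eq_iff)
      then show ?thesis using inj_onD[OF v(1)] assms(1) y st by blast
    qed
    then show "restrict (\<lambda>y. T y s) B = restrict (\<lambda>y. T y t) B" by (intro restrict_ext)
  qed
  also have "|(\<lambda>s. {(y, n). y \<in> B \<and> n \<in> v (T y s)}) ` S| \<le>o |Pow (B \<times> N)|"
    by (rule card_of_mono1) (use assms(1) v(2) in blast)
  finally show ?thesis .
qed

text \<open>A structure with a named sequence, transported to a fixed set; the code determines both up to isomorphism.\<close>

definition struct_code :: "('f, 'r) vocabulary \<Rightarrow> ('u, 'f, 'r) fo_struct \<Rightarrow> ('u \<Rightarrow> 'x) \<Rightarrow> ('i \<rightharpoonup> 'u) \<Rightarrow>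
    ('x + 'f \<times> 'x list \<times> 'x + 'r \<times> 'x list + 'i \<times> 'x) set" where
  "struct_code \<tau> M h a = h ` carrier M <+>
     {(F, map h xs, h (fun_in M F xs)) | F xs. F \<in> fun_syms \<tau> \<and> xs \<in> tuples (carrier M) (fun_ar \<tau> F)} <+>
     {(R, map h xs) | R xs. R \<in> rel_syms \<tau> \<and> xs \<in> rel_in M R} <+>
     {(i, y). map_option h (a i) = Some y}"

lemma Plus_eq_iff: "A <+> B = C <+> D \<longleftrightarrow> A = C \<and> B = D"
proof -
  have "Inl -` (X <+> Y) = X" "Inr -` (X <+> Y) = Y" for X :: "'x set" and Y :: "'y set"
    by auto
  then show ?thesis by metis
qed

text \<open>The isomorphism is \<open>h\<close> followed by the inverse of \<open>k\<close>. The
  summands of the code yield, in order, its bijectivity, the function symbols, the relation symbols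
  and the named sequence.\<close>

lemma iso_if_struct_code_eq:
  assumes M: "is_struct \<tau> M" and N: "is_struct \<tau> N"
    and h: "inj_on h (carrier M)" and k: "inj_on k (carrier N)"
    and a: "ran a \<subseteq> carrier M" and b: "ran b \<subseteq> carrier N"
    and eq: "struct_code \<tau> M h a = struct_code \<tau> N k b"
  obtains f where "is_iso \<tau> f M N" "map_option f \<circ> a = b"
proof -
  note all = eq[unfolded struct_code_def Plus_eq_iff]
  have c: "h ` carrier M = k ` carrier N"
    and fs: "{(F, map h xs, h (fun_in M F xs)) | F xs. F \<in> fun_syms \<tau> \<and> xs \<in> tuples (carrier M) (fun_ar \<tau> F)} =
      {(F, map k xs, k (fun_in N F xs)) | F xs. F \<in> fun_syms \<tau> \<and> xs \<in> tuples (carrier N) (fun_ar \<tau> F)}"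
    and rs: "{(R, map h xs) | R xs. R \<in> rel_syms \<tau> \<and> xs \<in> rel_in M R} =
      {(R, map k xs) | R xs. R \<in> rel_syms \<tau> \<and> xs \<in> rel_in N R}"
    and ab: "{(i, y). map_option h (a i) = Some y} = {(i, y). map_option k (b i) = Some y}"
    by (rule conjunct1[OF all], rule conjunct1[OF conjunct2[OF all]],
        rule conjunct1[OF conjunct2[OF conjunct2[OF all]]],
        rule conjunct2[OF conjunct2[OF conjunct2[OF all]]])
  define f where "f = inv_into (carrier N) k \<circ> h"
  have kf: "k (f x) = h x" if "x \<in> carrier M" for x
  proof -
    have "h x \<in> k ` carrier N" using that c by blast
    then show ?thesis unfolding f_def by (simp add: f_inv_into_f)
  qed
  have f_eq: "f x = y" if "h x = k y" "y \<in> carrier N" for x y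
    using that k by (simp add: f_def)
  have map_eq: "map f xs = ys" if "map h xs = map k ys" "set ys \<subseteq> carrier N" for xs ys
    using that f_eq by (induction xs arbitrary: ys) auto
  have kmap: "map k (map f xs) = map h xs" if "set xs \<subseteq> carrier M" for xs
    using that kf by (induction xs) auto
  have bij: "bij_betw f (carrier M) (carrier N)"
  proof -
    have "bij_betw h (carrier M) (k ` carrier N)" using h c by (simp add: bij_betw_def)
    moreover have "bij_betw (inv_into (carrier N) k) (k ` carrier N) (carrier N)"
      using k by (intro bij_betw_inv_into) (simp add: bij_betw_def)
    ultimately show ?thesis unfolding f_def by (rule bij_betw_trans)
  qed
  have "f (fun_in M F xs) = fun_in N F (map f xs)"
    if F: "F \<in> fun_syms \<tau>" and xs: "xs \<in> tuples (carrier M) (fun_ar \<tau> F)" for F xs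
  proof -
    have "(F, map h xs, h (fun_in M F xs)) \<in>
        {(F, map k xs, k (fun_in N F xs)) | F xs. F \<in> fun_syms \<tau> \<and> xs \<in> tuples (carrier N) (fun_ar \<tau> F)}"
      unfolding fs[symmetric] using F xs by blast
    then obtain ys where ys: "ys \<in> tuples (carrier N) (fun_ar \<tau> F)" "map h xs = map k ys"
      "h (fun_in M F xs) = k (fun_in N F ys)" by blast
    have "fun_in N F ys \<in> carrier N" using N F ys(1) unfolding is_struct_def by blast
    then have "f (fun_in M F xs) = fun_in N F ys" by (rule f_eq[OF ys(3)])
    moreover have "map f xs = ys" using ys by (intro map_eq) (auto simp: tuples_def)
    ultimately show ?thesis by simp
  qed
  moreover have "xs \<in> rel_in M R \<longleftrightarrow> map f xs \<in> rel_in N R"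
    if R: "R \<in> rel_syms \<tau>" and xs: "xs \<in> tuples (carrier M) (rel_ar \<tau> R)" for R xs
  proof
    assume "xs \<in> rel_in M R"
    then have "(R, map h xs) \<in> {(R, map k xs) | R xs. R \<in> rel_syms \<tau> \<and> xs \<in> rel_in N R}"
      unfolding rs[symmetric] using R by blast
    then obtain ys where ys: "ys \<in> rel_in N R" "map h xs = map k ys" by blast
    have "set ys \<subseteq> carrier N" using N R ys(1) unfolding is_struct_def tuples_def by blast
    then show "map f xs \<in> rel_in N R" using map_eq[OF ys(2)] ys(1) by simp
  next
    assume "map f xs \<in> rel_in N R"
    then have "(R, map k (map f xs)) \<in> {(R, map h xs) | R xs. R \<in> rel_syms \<tau> \<and> xs \<in> rel_in M R}"
      unfolding rs using R by blast
    moreover have sx: "set xs \<subseteq> carrier M" using xs by (simp add: tuples_def)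
    ultimately obtain ys where ys: "ys \<in> rel_in M R" "map h xs = map h ys"
      unfolding kmap[OF sx] by blast
    have "set ys \<subseteq> carrier M" using M R ys(1) unfolding is_struct_def tuples_def by blast
    then have "xs = ys" using map_inv_into_map[OF h] sx ys(2) by metis
    then show "xs \<in> rel_in M R" using ys(1) by simp
  qed
  ultimately have "is_iso \<tau> f M N" using bij unfolding is_iso_def by blast
  moreover have "map_option f (a i) = b i" for i
  proof (cases "b i")
    case None
    then have "(i, y) \<notin> {(i, y). map_option h (a i) = Some y}" for y unfolding ab by simp
    then show ?thesis using None by (cases "a i") auto
  next
    case (Some y)
    then have "(i, k y) \<in> {(i, y). map_option h (a i) = Some y}" unfolding ab by simp
    then obtain x where x: "a i = Some x" "h x = k y" by auto
    have "y \<in> carrier N" using Some b by (auto simp: ran_def)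
    then show ?thesis using x Some f_eq by simp
  qed
  then have "map_option f \<circ> a = b" by auto
  ultimately show thesis by (rule that)
qed

lemma Plus_mono: "A \<subseteq> C \<Longrightarrow> B \<subseteq> D \<Longrightarrow> A <+> B \<subseteq> C <+> D"
  by auto

lemma struct_code_subset:
  assumes M: "is_struct \<tau> M" and h: "h ` carrier M \<subseteq> Z" and a: "a \<in> seqs J (carrier M)"
  shows "struct_code \<tau> M h a \<subseteq> Z <+> (fun_syms \<tau> \<times> {xs. set xs \<subseteq> Z} \<times> Z) <+>
    (rel_syms \<tau> \<times> {xs. set xs \<subseteq> Z}) <+> (J \<times> Z)"
proof -
  have "h (fun_in M F xs) \<in> Z" if "F \<in> fun_syms \<tau>" "xs \<in> tuples (carrier M) (fun_ar \<tau> F)" for F xs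
    using M that h unfolding is_struct_def by blast
  moreover have "set (map h xs) \<subseteq> Z" if "xs \<in> tuples (carrier M) n" for xs n
    using that h by (auto simp: tuples_def)
  moreover have "xs \<in> tuples (carrier M) (rel_ar \<tau> R)"
    if "R \<in> rel_syms \<tau>" "xs \<in> rel_in M R" for R xs
    using M that unfolding is_struct_def by blast
  moreover have "i \<in> J \<and> y \<in> Z" if "map_option h (a i) = Some y" for i y
    using that a h by (auto simp: seqs_def ran_def)
  ultimately show ?thesis unfolding struct_code_def using h by (intro Plus_mono) blast+
qed

context AEC
begin

lemma gtp_strong:
  assumes s: "strong K M N" and A: "A \<subseteq> carrier M" and a: "ran a \<subseteq> carrier M"
  shows "gtp K a A M = gtp K a A N"
proof -
  have MN: "M \<in> models K" "N \<in> models K" "carrier M \<subseteq> carrier N"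
    using strong_models[OF s] strong_substruct[OF s] by (auto simp: substruct_def)
  have "((a, A, M), (a, A, N)) \<in> gal_step K"
    unfolding gal_step_iff using MN A a K_embedding_strong[OF s] K_embedding_id[OF MN(2)]
    by (intro conjI bexI[of _ N] exI[of _ id]) auto
  then show ?thesis by (intro gtp_eqI r_into_trancl)
qed

lemma gtp_iso:
  assumes f: "is_iso (vocab K) f M N" and MN: "M \<in> models K" "N \<in> models K"
    and a: "ran a \<subseteq> carrier M"
  shows "gtp K a {} M = gtp K (map_option f \<circ> a) {} N"
proof -
  have "ran (map_option f \<circ> a) \<subseteq> carrier N"
    using f a by (auto simp: ran_map_option_comp is_iso_def bij_betw_def)
  then have "((a, {}, M), (map_option f \<circ> a, {}, N)) \<in> gal_step K"
    unfolding gal_step_iff using MN a K_embedding_iso[OF f MN(2)] K_embedding_id[OF MN(2)]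
    by (intro conjI bexI[of _ N] exI[of _ f] exI[of _ id]) (auto simp: option.map_id0)
  then show ?thesis by (intro gtp_eqI r_into_trancl)
qed

lemma Cinfinite_LS: "Cinfinite (LS K)"
proof -
  have "natLeq \<le>o LS K" using LS_is_LS_bound unfolding is_LS_bound_def by (elim conjE)
  from cinfinite_mono[OF this natLeq_cinfinite] show ?thesis using LS_is_LS_bound by simp
qed

text \<open>By Loewenheim-Skolem each sequence lies in a strong submodel of size at most
  \<open>\<rho>\<close>, which does not change its type. Isomorphic pairs of model and sequence have
  the same type over the empty set, and up to isomorphism such a pair is a subset of a set of size
  \<open>\<rho>\<close>.\<close>

lemma card_of_gtps:
  fixes \<rho> :: "'p rel" and J :: "'j set"
  assumes rho: "Cinfinite \<rho>" and J: "|J| \<le>o \<rho>" and LS: "LS K \<le>o \<rho>"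
  shows "|{gtp K a {} M | M a. M \<in> models K \<and> a \<in> seqs J (carrier M)}| \<le>o exp2 \<rho>"
proof -
  let ?\<tau> = "vocab K"
  let ?X = "{(M, a). M \<in> models K \<and> a \<in> seqs J (carrier M)}"
  let ?Z = "Field \<rho>"
  have "\<forall>p \<in> ?X. \<exists>q :: _ \<times> ('u \<Rightarrow> 'p). strong K (fst q) (fst p) \<and> ran (snd p) \<subseteq> carrier (fst q) \<and>
      inj_on (snd q) (carrier (fst q)) \<and> snd q ` carrier (fst q) \<subseteq> ?Z"
  proof
    fix p assume p: "p \<in> ?X"
    obtain M a where Ma: "p = (M, a)" "M \<in> models K" "a \<in> seqs J (carrier M)" using p by auto
    have dom: "dom a = J" and ran: "ran a \<subseteq> carrier M" using Ma(3) by (auto simp: seqs_def)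
    obtain N where N: "strong K N M" "ran a \<subseteq> carrier N" "|carrier N| \<le>o |ran a| +c LS K"
      using LS_is_LS_bound Ma(2) ran unfolding is_LS_bound_def by blast
    have "|ran a| \<le>o \<rho>"
      unfolding ran_eq_image_dom dom by (rule ordLeq_transitive[OF card_of_image J])
    then have "|ran a| +c LS K \<le>o \<rho>"
      using LS Cinfinite_LS rho by (intro csum_cinfinite_bound card_of_Card_order) auto
    then have "|carrier N| \<le>o \<rho>" by (rule ordLeq_transitive[OF N(3)])
    then have "|carrier N| \<le>o |?Z|"
      using rho card_of_mono2[of "|carrier N|" \<rho>] by (simp add: Field_card_of)
    then obtain h where "inj_on h (carrier N)" "h ` carrier N \<subseteq> ?Z"
      using card_of_ordLeq[of "carrier N" ?Z] by blast
    then show "\<exists>q :: _ \<times> ('u \<Rightarrow> 'p). strong K (fst q) (fst p) \<and> ran (snd p) \<subseteq> carrier (fst q) \<and>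
        inj_on (snd q) (carrier (fst q)) \<and> snd q ` carrier (fst q) \<subseteq> ?Z"
      using N Ma(1) by (intro exI[of _ "(N, h)"]) simp
  qed
  from bchoice[OF this] obtain w where w: "\<forall>p \<in> ?X. strong K (fst (w p)) (fst p) \<and>
      ran (snd p) \<subseteq> carrier (fst (w p)) \<and> inj_on (snd (w p)) (carrier (fst (w p))) \<and>
      snd (w p) ` carrier (fst (w p)) \<subseteq> ?Z" ..
  define N where "N p = fst (w p)" for p
  define h where "h p = snd (w p)" for p
  have Nh: "strong K (N p) (fst p) \<and> ran (snd p) \<subseteq> carrier (N p) \<and>
      inj_on (h p) (carrier (N p)) \<and> h p ` carrier (N p) \<subseteq> ?Z" if "p \<in> ?X" for p
    using bspec[OF w that] unfolding N_def h_def .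
  let ?c = "\<lambda>p. struct_code ?\<tau> (N p) (h p) (snd p)"
  \<comment> \<open>All codes are subsets of this set. Its size is at most \<open>\<rho>\<close>
    because arities are finite and the vocabulary is bounded by \<open>LS K\<close>.\<close>
  let ?W = "?Z <+> (fun_syms ?\<tau> \<times> {xs. set xs \<subseteq> ?Z} \<times> ?Z) <+>
    (rel_syms ?\<tau> \<times> {xs. set xs \<subseteq> ?Z}) <+> (J \<times> ?Z)"
  have NM: "N p \<in> models K" if "p \<in> ?X" for p
    using Nh[OF that] strong_models[of "N p" "fst p"] by blast
  have "{gtp K a {} M | M a. M \<in> models K \<and> a \<in> seqs J (carrier M)} \<subseteq>
      (\<lambda>p. gtp K (snd p) {} (fst p)) ` ?X"
  proof
    fix t assume "t \<in> {gtp K a {} M | M a. M \<in> models K \<and> a \<in> seqs J (carrier M)}"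
    then obtain M a where "t = gtp K a {} M" "M \<in> models K" "a \<in> seqs J (carrier M)" by blast
    then show "t \<in> (\<lambda>p. gtp K (snd p) {} (fst p)) ` ?X"
      by (intro image_eqI[of _ _ "(M, a)"]) simp_all
  qed
  then have "|{gtp K a {} M | M a. M \<in> models K \<and> a \<in> seqs J (carrier M)}| \<le>o
      |(\<lambda>p. gtp K (snd p) {} (fst p)) ` ?X|" by (rule card_of_mono1)
  also have "|(\<lambda>p. gtp K (snd p) {} (fst p)) ` ?X| \<le>o |?c ` ?X|"
  proof (rule card_of_image_kernel)
    fix p q assume p: "p \<in> ?X" and q: "q \<in> ?X" and eq: "?c p = ?c q"
    have rp: "ran (snd p) \<subseteq> carrier (N p)" and rq: "ran (snd q) \<subseteq> carrier (N q)"
      using Nh p q by auto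
    obtain f where f: "is_iso ?\<tau> f (N p) (N q)" "map_option f \<circ> snd p = snd q"
      by (rule iso_if_struct_code_eq[OF models_struct[OF NM[OF p]] models_struct[OF NM[OF q]] _ _ rp rq eq])
        (use Nh[OF p] Nh[OF q] in simp_all)
    have "gtp K (snd p) {} (fst p) = gtp K (snd p) {} (N p)"
      using Nh[OF p] by (intro gtp_strong[symmetric]) auto
    also have "\<dots> = gtp K (snd q) {} (N q)"
      using gtp_iso[OF f(1) NM[OF p] NM[OF q] rp] f(2) by simp
    also have "\<dots> = gtp K (snd q) {} (fst q)"
      using Nh[OF q] by (intro gtp_strong) auto
    finally show "gtp K (snd p) {} (fst p) = gtp K (snd q) {} (fst q)" .
  qed
  also have "|?c ` ?X| \<le>o |Pow ?W|"
  proof (rule card_of_mono1, rule image_subsetI)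
    fix p assume p: "p \<in> ?X"
    have "snd p \<in> seqs J (carrier (N p))" using p Nh[OF p] by (auto simp: seqs_def)
    then have "?c p \<subseteq> ?W"
      using Nh[OF p] by (intro struct_code_subset models_struct NM p) auto
    then show "?c p \<in> Pow ?W" by (rule PowI)
  qed
  also have "|Pow ?W| \<le>o exp2 \<rho>"
  proof (rule card_of_Pow_le_exp2)
    have inf: "\<not> finite ?Z" and c: "Card_order \<rho>" using rho by (auto simp: cinfinite_def)
    have Z: "|?Z| \<le>o \<rho>" using card_of_Field_ordIso[OF c] by (rule ordIso_imp_ordLeq)
    have L: "|{xs. set xs \<subseteq> ?Z}| \<le>o \<rho>" by (rule card_of_lists_Cinfinite[OF rho Z])
    have "|fun_syms ?\<tau> <+> rel_syms ?\<tau>| \<le>o LS K"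
      using LS_is_LS_bound unfolding is_LS_bound_def by (elim conjE)
    then have "|fun_syms ?\<tau> <+> rel_syms ?\<tau>| \<le>o \<rho>" by (rule ordLeq_transitive[OF _ LS])
    then have "|fun_syms ?\<tau>| \<le>o \<rho>" "|rel_syms ?\<tau>| \<le>o \<rho>"
      by (rule ordLeq_transitive[OF card_of_Plus1], rule ordLeq_transitive[OF card_of_Plus2])
    then show "|?W| \<le>o \<rho>"
      by (intro card_of_Plus_ordLeq_infinite_Field card_of_Times_ordLeq_infinite_Field inf c Z L J)
  qed
  finally show ?thesis .
qed

end

section \<open>Stability from tameness and the failure of the order property\<close>

text \<open>Whether the \<open>x\<close> of the first sequence separates \<open>b\<close> from
  \<open>c\<close> of the second is an invariant of the type of the concatenation. It fails for
  every increasing pair and holds for every decreasing pair.\<close>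

lemma order_property_if_triples:
  fixes K :: "('u, 'f, 'r) abstract_class" and \<chi> :: "'m rel" and \<beta> :: "'i rel"
    and x :: "'m \<Rightarrow> 'u" and b c :: "'m \<Rightarrow> 'j \<rightharpoonup> 'u"
  assumes K: "AEC K" and M: "M \<in> models K"
    and J: "|{()} <+> J <+> J| \<le>o |Field \<beta>|"
    and s: "\<And>i. i \<in> Field \<chi> \<Longrightarrow> x i \<in> carrier M \<and> b i \<in> seqs J (carrier M) \<and> c i \<in> seqs J (carrier M)"
    and T: "\<And>i j. (i, j) \<in> \<chi> \<Longrightarrow> i \<noteq> j \<Longrightarrow>
      gtp K (case_option (Some (x i)) (b j)) {} M = gtp K (case_option (Some (x i)) (c j)) {} M \<and>
      gtp K (case_option (Some (x j)) (b i)) {} M \<noteq> gtp K (case_option (Some (x j)) (c i)) {} M"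
  shows "order_property K \<beta> \<chi>"
proof -
  interpret AEC K by (rule K)
  \<comment> \<open>A surjection is enough: if \<open>\<beta>\<close> has more positions than the
    triple has entries, entries are repeated.\<close>
  have "\<exists>g. g ` Field \<beta> = {()} <+> J <+> J"
    using J card_of_ordLeq2[of "{()} <+> J <+> J" "Field \<beta>"] by blast
  then obtain g where g: "g ` Field \<beta> = {()} <+> J <+> J" by (elim exE)
  define h where "h = inv_into (Field \<beta>) g"
  have h: "h y \<in> Field \<beta>" "g (h y) = y" if "y \<in> {()} <+> J <+> J" for y
    using that g unfolding h_def by (auto simp: inv_into_into f_inv_into_f)
  \<comment> \<open>\<open>a i\<close> is the concatenation of \<open>x i\<close>, \<open>b i\<close> and \<open>c i\<close>, spread over \<open>\<beta>\<close> along the surjection \<open>g\<close>.\<close>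
  define a where "a i = (\<lambda>t. if t \<in> Field \<beta>
    then case_sum (\<lambda>_. Some (x i)) (case_sum (b i) (c i)) (g t) else None)" for i
  \<comment> \<open>\<open>rb\<close> reads \<open>x\<close> off the first half of a concatenation
    and \<open>b\<close> off the second; \<open>rc\<close> does the same with
    \<open>c\<close>.\<close>
  define rb where "rb k = (case k of None \<Rightarrow> Some (Inl (h (Inl ())))
    | Some k \<Rightarrow> if k \<in> J then Some (Inr (h (Inr (Inl k)))) else None)" for k
  define rc where "rc k = (case k of None \<Rightarrow> Some (Inl (h (Inl ())))
    | Some k \<Rightarrow> if k \<in> J then Some (Inr (h (Inr (Inr k)))) else None)" for k
  have ab: "case_sum (a i) (a j) \<circ>\<^sub>m rb = case_option (Some (x i)) (b j)"
    and ac: "case_sum (a i) (a j) \<circ>\<^sub>m rc = case_option (Some (x i)) (c j)"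
    if "j \<in> Field \<chi>" for i j
  proof -
    have d: "b j k = None" "c j k = None" if "k \<notin> J" for k
      using s[OF \<open>j \<in> Field \<chi>\<close>] that by (auto simp: seqs_def)
    have "h (Inl ()) \<in> Field \<beta>" "g (h (Inl ())) = Inl ()"
      using h[of "Inl ()"] by auto
    moreover have "h (Inr (Inl k)) \<in> Field \<beta>" "g (h (Inr (Inl k))) = Inr (Inl k)"
      "h (Inr (Inr k)) \<in> Field \<beta>" "g (h (Inr (Inr k))) = Inr (Inr k)" if "k \<in> J" for k
      using that h[of "Inr (Inl k)"] h[of "Inr (Inr k)"] by auto
    ultimately have "(case_sum (a i) (a j) \<circ>\<^sub>m rb) k = case_option (Some (x i)) (b j) k"
      "(case_sum (a i) (a j) \<circ>\<^sub>m rc) k = case_option (Some (x i)) (c j) k" for k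
      using d by (cases k; simp add: rb_def rc_def a_def map_comp_def)+
    then show "case_sum (a i) (a j) \<circ>\<^sub>m rb = case_option (Some (x i)) (b j)"
      "case_sum (a i) (a j) \<circ>\<^sub>m rc = case_option (Some (x i)) (c j)" by auto
  qed
  have da: "dom (a i) = Field \<beta>" and ra: "ran (a i) \<subseteq> carrier M" if i: "i \<in> Field \<chi>" for i
  proof -
    have bc: "dom (b i) = J" "dom (c i) = J" "ran (b i) \<subseteq> carrier M" "ran (c i) \<subseteq> carrier M"
      "x i \<in> carrier M" using s[OF i] by (auto simp: seqs_def)
    have v: "\<exists>y \<in> carrier M. a i t = Some y" if t: "t \<in> Field \<beta>" for t
    proof -
      have "g t \<in> {()} <+> J <+> J" using g t by blast
      then consider "g t = Inl ()" | k where "g t = Inr (Inl k)" "k \<in> J"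
        | k where "g t = Inr (Inr k)" "k \<in> J" by auto
      then show ?thesis
      proof cases
        case 1
        then show ?thesis using t bc by (simp add: a_def)
      next
        case (2 k)
        then obtain y where "b i k = Some y" using bc(1) by blast
        then show ?thesis using 2 t bc(3) ranI[of "b i" k y] by (auto simp: a_def)
      next
        case (3 k)
        then obtain y where "c i k = Some y" using bc(2) by blast
        then show ?thesis using 3 t bc(4) ranI[of "c i" k y] by (auto simp: a_def)
      qed
    qed
    show "dom (a i) = Field \<beta>" using v by (auto simp: a_def dom_def)
    show "ran (a i) \<subseteq> carrier M"
    proof
      fix y assume "y \<in> ran (a i)"
      then obtain t where t: "a i t = Some y" by (auto simp: ran_def)
      then have "t \<in> Field \<beta>" by (simp add: a_def split: if_splits)
      then show "y \<in> carrier M" using v t by fastforce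
    qed
  qed
  have "gtp K (case_sum (a i0) (a i1)) {} M \<noteq> gtp K (case_sum (a j1) (a j0)) {} M"
    if i: "(i0, i1) \<in> \<chi>" "i0 \<noteq> i1" and j: "(j0, j1) \<in> \<chi>" "j0 \<noteq> j1" for i0 i1 j0 j1
  proof
    assume eq: "gtp K (case_sum (a i0) (a i1)) {} M = gtp K (case_sum (a j1) (a j0)) {} M"
    have F: "i0 \<in> Field \<chi>" "i1 \<in> Field \<chi>" "j0 \<in> Field \<chi>" "j1 \<in> Field \<chi>"
      using i j by (auto simp: Field_def)
    have ran_sum: "ran (case_sum u v) \<subseteq> ran u \<union> ran v" for u v :: "'i \<rightharpoonup> 'u"
    proof
      fix y assume "y \<in> ran (case_sum u v)"
      then obtain k where "case_sum u v k = Some y" by (auto simp: ran_def)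
      then show "y \<in> ran u \<union> ran v" by (cases k) (auto intro: ranI)
    qed
    have r: "ran (case_sum (a i0) (a i1)) \<subseteq> carrier M" "ran (case_sum (a j1) (a j0)) \<subseteq> carrier M"
      by (rule subset_trans[OF ran_sum]; use ra F in simp)+
    have "gtp K (case_option (Some (x i0)) (b i1)) {} M = gtp K (case_option (Some (x j1)) (b j0)) {} M"
      using gtp_reindex[OF M _ r(1) M _ r(2) eq, of rb] unfolding ab[OF F(2)] ab[OF F(3)] by simp
    moreover have "gtp K (case_option (Some (x i0)) (c i1)) {} M = gtp K (case_option (Some (x j1)) (c j0)) {} M"
      using gtp_reindex[OF M _ r(1) M _ r(2) eq, of rc] unfolding ac[OF F(2)] ac[OF F(3)] by simp
    ultimately show False using T[OF i] T[OF j] by simp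
  qed
  then show ?thesis
    unfolding order_property_def using M da ra by (intro bexI[of _ M] exI[of _ a]) blast+
qed

lemma Field_natLeq_on_2: "Field (natLeq_on 2) = {0, 1}"
proof -
  have "{x. x < (2::nat)} = {0, 1}" by auto
  then show ?thesis using Field_natLeq_on[of 2] by simp
qed

lemma ordinals_below_2:
  "ordinals_below (natLeq_on 2) = {{}, {(0, 0)}}"
proof -
  have "underS (natLeq_on 2) 0 = {}" "underS (natLeq_on 2) 1 = {0}"
    by (auto simp: underS_def)
  moreover have "Restr (natLeq_on 2) {0} = {(0, 0)}" by auto
  ultimately show ?thesis
    unfolding ordinals_below_def Field_natLeq_on_2 by auto
qed

text \<open>Proper initial segments of \<open>\<kappa>\<close> serve both as index sets for
  parameter sets of size below \<open>\<kappa>\<close> and as the lengths allowed in the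
  \<open>(<\<kappa>)\<close>-order property.\<close>

lemma ex_initial_segment:
  assumes k: "Card_order \<kappa>" and X: "|X| <o \<kappa>"
  obtains z where "z \<in> Field \<kappa>" "|X| =o |underS \<kappa> z|"
    "Restr \<kappa> (underS \<kappa> z) \<in> ordinals_below \<kappa>" "Field (Restr \<kappa> (underS \<kappa> z)) = underS \<kappa> z"
proof -
  have W: "Well_order \<kappa>" using k card_order_on_well_order_on by blast
  obtain z where z: "z \<in> Field \<kappa>" "|X| =o Restr \<kappa> (underS \<kappa> z)"
    using X unfolding ordLess_iff_ordIso_Restr[OF W card_of_Well_order] by blast
  have F: "Field (Restr \<kappa> (underS \<kappa> z)) = underS \<kappa> z"
    using W by (intro Field_Restr_ofilter) (simp_all add: wo_rel_def wo_rel.underS_ofilter)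
  have "|X| =o |underS \<kappa> z|"
    using card_of_cong[OF z(2)] unfolding F Field_card_of .
  then show thesis using that z F unfolding ordinals_below_def by blast
qed

lemma ran_case_option: "ran (case_option (Some x) b) = insert x (ran b)"
proof
  show "ran (case_option (Some x) b) \<subseteq> insert x (ran b)"
  proof
    fix y assume "y \<in> ran (case_option (Some x) b)"
    then obtain k where k: "case_option (Some x) b k = Some y" by (auto simp: ran_def)
    then show "y \<in> insert x (ran b)" by (cases k) (auto intro: ranI)
  qed
  show "insert x (ran b) \<subseteq> ran (case_option (Some x) b)"
  proof
    fix y assume "y \<in> insert x (ran b)"
    then consider "y = x" | i where "b i = Some y" by (auto simp: ran_def)
    then show "y \<in> ran (case_option (Some x) b)"
    proof cases
      case 1
      then show ?thesis by (intro ranI[of _ None]) simp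
    next
      case (2 i)
      then show ?thesis by (intro ranI[of _ "Some i"]) simp
    qed
  qed
qed

lemma case_option_in_seqs:
  assumes "x \<in> X" "b \<in> seqs J X"
  shows "case_option (Some x) b \<in> seqs (insert None (Some ` J)) X"
proof -
  have "dom (case_option (Some x) b) = insert None (Some ` dom b)"
  proof (rule set_eqI)
    fix k show "k \<in> dom (case_option (Some x) b) \<longleftrightarrow> k \<in> insert None (Some ` dom b)"
      by (cases k) auto
  qed
  then show ?thesis using assms by (auto simp: seqs_def ran_case_option)
qed

context AEC
begin

lemma gS_less_in_2_subset:
  "gS_less_in K (natLeq_on 2) A M \<subseteq>
    {gtp K Map.empty A M} \<union> (\<lambda>x. gtp K [0 \<mapsto> x] A M) ` carrier M"
proof
  fix p assume "p \<in> gS_less_in K (natLeq_on 2) A M"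
  then obtain \<beta> a where ba: "\<beta> \<in> {{}, {(0, 0)}}" "dom a = Field \<beta>" "ran a \<subseteq> carrier M"
    "p = gtp K a A M"
    unfolding gS_less_in_def gS_in_def ordinals_below_2 by blast
  show "p \<in> {gtp K Map.empty A M} \<union> (\<lambda>x. gtp K [0 \<mapsto> x] A M) ` carrier M"
  proof (cases "\<beta> = {}")
    case True
    then have "a = Map.empty" using ba(2) by simp
    then show ?thesis using ba(4) by simp
  next
    case False
    then have "dom a = {0}" using ba(1,2) by simp
    then obtain x where a: "a = [0 \<mapsto> x]" using dom_eq_singleton_conv by metis
    then have "x \<in> carrier M" using ba(3) by simp
    then show ?thesis using ba(4) a by blast
  qed
qed

lemma gtp_in_gS_less_2:
  assumes "M \<in> models K" "A \<subseteq> carrier M" "x \<in> carrier M"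
  shows "gtp K [0 \<mapsto> x] A M \<in> gS_less K (natLeq_on 2) A"
proof -
  have "gtp K [0 \<mapsto> x] A M \<in> gS_in K {(0 :: nat, 0)} A M"
    unfolding gS_in_def using assms(3) by (intro CollectI exI[of _ "[0 \<mapsto> x]"]) simp
  then have "gtp K [0 \<mapsto> x] A M \<in> gS_less_in K (natLeq_on 2) A M"
    unfolding gS_less_in_def ordinals_below_2 by simp
  then show ?thesis unfolding gS_less_def using assms(1,2) by blast
qed

lemma tame_gtp_eq:
  assumes t: "tame_less K \<kappa>" and M: "M \<in> models K" "A \<subseteq> carrier M" and xy: "x \<in> carrier M" "y \<in> carrier M"
    and eq: "\<And>A0. A0 \<subseteq> A \<Longrightarrow> |A0| <o \<kappa> \<Longrightarrow> gtp K [0 :: nat \<mapsto> x] A0 M = gtp K [0 :: nat \<mapsto> y] A0 M"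
  shows "gtp K [0 :: nat \<mapsto> x] A M = gtp K [0 :: nat \<mapsto> y] A M"
proof (rule ccontr)
  assume ne: "gtp K [0 :: nat \<mapsto> x] A M \<noteq> gtp K [0 :: nat \<mapsto> y] A M"
  have r: "gtp_restrict K (gtp K [0 :: nat \<mapsto> z] A M) A0 = gtp K [0 :: nat \<mapsto> z] A0 M"
    if "z \<in> carrier M" "A0 \<subseteq> A" for z A0
    using that M by (intro gtp_restrict_gtp) auto
  obtain A0 where "A0 \<subseteq> A" "|A0| <o \<kappa>"
    "gtp_restrict K (gtp K [0 :: nat \<mapsto> x] A M) A0 \<noteq> gtp_restrict K (gtp K [0 :: nat \<mapsto> y] A M) A0"
    using t[unfolded tame_less_def, THEN spec, THEN mp, THEN bspec, THEN bspec, THEN mp,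
        OF bexI[of "\<lambda>M. A \<subseteq> carrier M", OF M(2) M(1)] gtp_in_gS_less_2[OF M xy(1)] gtp_in_gS_less_2[OF M xy(2)] ne]
    by (elim exE conjE)
  then show False using eq r xy by metis
qed

text \<open>The common core of all three bounds. \<open>JJ\<close> holds index sets for the small
  parameter sets supplied by tameness, \<open>\<beta> J\<close> is a length that has room for an
  element and two \<open>J\<close>-sequences, and \<open>N J\<close> is an exponent bounding the
  types of an element with a \<open>J\<close>-sequence.\<close>

theorem card_of_gS_if_no_order_property:
  fixes \<theta> :: "'h rel" and \<chi> :: "'c rel" and \<kappa> :: "'k rel" and JJ :: "'j set set"
    and \<beta> :: "'j set \<Rightarrow> 'b rel" and N :: "'j set \<Rightarrow> 'n set"
  assumes inf: "infinite (UNIV :: 'u set)"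
    and th: "Cinfinite \<theta>" and ch: "Card_order \<chi>" "\<chi> \<le>o \<theta>"
    and JJ: "|JJ| \<le>o \<theta>" and J: "\<And>J. J \<in> JJ \<Longrightarrow> |J| \<le>o \<theta>"
    and types: "\<And>J M. J \<in> JJ \<Longrightarrow> M \<in> models K \<Longrightarrow>
      |(\<lambda>a. gtp K a {} M) ` seqs (insert None (Some ` J)) (carrier M)| \<le>o |Pow (N J)|"
    and N: "\<And>J. J \<in> JJ \<Longrightarrow> |N J| \<le>o \<theta>"
    and Pow_N: "\<And>J (B :: 'u set). J \<in> JJ \<Longrightarrow> |B| <o \<chi> \<Longrightarrow> |Pow (B \<times> N J)| \<le>o \<theta>"
    and enum: "\<And>A0 :: 'u set. |A0| <o \<kappa> \<Longrightarrow> \<exists>J \<in> JJ. |A0| =o |J| \<or> A0 \<noteq> {} \<and> |A0| \<le>o |J|"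
    and no_order: "\<And>J. J \<in> JJ \<Longrightarrow> |{()} <+> J <+> J| \<le>o |Field (\<beta> J)| \<and> \<not> order_property K (\<beta> J) \<chi>"
    and tame: "tame_less K \<kappa>"
    and M: "M \<in> models K" and A: "A \<subseteq> carrier M" "|A| \<le>o exp2 \<theta>"
  shows "|gS_less_in K (natLeq_on 2) A M| \<le>o exp2 \<theta>"
proof -
  let ?T = "\<lambda>x (b :: 'j \<rightharpoonup> 'u). gtp K (case_option (Some x) b) {} M"
  let ?f = "\<lambda>x. gtp K [0 :: nat \<mapsto> x] A M"
  let ?S = "\<Union>J \<in> JJ. seqs J A"
  have count: "|(\<lambda>x. restrict (?T x) ?S) ` carrier M| \<le>o exp2 \<theta>"
  proof (rule card_of_types_if_no_order[OF th ch JJ J _ _ _ A])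
    fix J assume JJ: "J \<in> JJ"
    have "(\<lambda>(x, b). ?T x b) ` (carrier M \<times> seqs J (carrier M)) \<subseteq>
        (\<lambda>a. gtp K a {} M) ` seqs (insert None (Some ` J)) (carrier M)"
      using case_option_in_seqs[of _ "carrier M" _ J] by auto
    then show "|(\<lambda>(x, b). ?T x b) ` (carrier M \<times> seqs J (carrier M))| \<le>o exp2 \<theta>"
      by (rule ordLeq_transitive[OF card_of_mono1 ordLeq_transitive[OF types[OF JJ M]
            card_of_Pow_le_exp2[OF N[OF JJ]]]])
  next
    fix J and B :: "'u set" assume JB: "J \<in> JJ" "B \<subseteq> carrier M" "|B| <o \<chi>"
    show "|(\<lambda>b. restrict (\<lambda>y. ?T y b) B) ` seqs J (carrier M)| \<le>o \<theta>"
      by (rule ordLeq_transitive[OF card_of_restrict_image[OF _ types[OF JB(1) M]] Pow_N[OF JB(1,3)]])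
        (use JB(2) in \<open>auto intro!: imageI case_option_in_seqs\<close>)
  next
    fix J and x :: "'c \<Rightarrow> 'u" and b c :: "'c \<Rightarrow> 'j \<rightharpoonup> 'u"
    assume JJ: "J \<in> JJ"
      and s: "\<And>i. i \<in> Field \<chi> \<Longrightarrow> x i \<in> carrier M \<and> b i \<in> seqs J (carrier M) \<and> c i \<in> seqs J (carrier M)"
      and T: "\<And>i j. (i, j) \<in> \<chi> \<Longrightarrow> i \<noteq> j \<Longrightarrow>
         ?T (x i) (b j) = ?T (x i) (c j) \<and> ?T (x j) (b i) \<noteq> ?T (x j) (c i)"
    have "order_property K (\<beta> J) \<chi>"
      by (rule order_property_if_triples[OF AEC_axioms M _ s T]) (use no_order[OF JJ] in auto)
    then show False using no_order[OF JJ] by simp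
  qed
  have "|?f ` carrier M| \<le>o |(\<lambda>x. restrict (?T x) ?S) ` carrier M|"
  proof (rule card_of_image_kernel)
    fix x y assume xy: "x \<in> carrier M" "y \<in> carrier M"
      and eq: "restrict (?T x) ?S = restrict (?T y) ?S"
    show "?f x = ?f y"
    proof (rule tame_gtp_eq[OF tame M A(1) xy])
      fix A0 assume A0: "A0 \<subseteq> A" "|A0| <o \<kappa>"
      obtain J where J: "J \<in> JJ" "|A0| =o |J| \<or> A0 \<noteq> {} \<and> |A0| \<le>o |J|" using enum[OF A0(2)] by blast
      \<comment> \<open>A nonempty \<open>J\<close> cannot be mapped onto the empty set, which is
        why \<open>enum\<close> demands an equinumerous index set when \<open>A0\<close> is
        empty.\<close>
      have "\<exists>g. g ` J = A0"
      proof (cases "A0 = {}")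
        case True
        then have "|A0| =o |J|" using J(2) by blast
        then have "J = {}" using True card_of_empty2 ordIso_symmetric by blast
        then show ?thesis using True by simp
      next
        case False
        have "|A0| \<le>o |J|" using J(2) ordIso_imp_ordLeq by blast
        then show ?thesis using card_of_ordLeq2[OF False, of J] by blast
      qed
      then obtain g where g: "g ` J = A0" ..
      define b where "b i = (if i \<in> J then Some (g i) else None)" for i
      have dom: "dom b = J" and ran: "ran b = A0" using g by (auto simp: b_def dom_def ran_def)
      have "b \<in> ?S" using J(1) dom ran A0(1) by (auto simp: seqs_def)
      then have "?T x b = ?T y b" using fun_cong[OF eq, of b] by (simp only: restrict_apply')
      moreover have cb: "case_option (Some z) b \<circ>\<^sub>m (\<lambda>i. Some (Some i)) = b" for z
        by (auto simp: map_comp_def)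
      have r: "ran (case_option (Some z) b) \<subseteq> carrier M" if "z \<in> carrier M" for z
        using that ran A0(1) A(1) by (auto simp: ran_case_option)
      ultimately have over: "gtp K (case_option (Some x) b) A0 M = gtp K (case_option (Some y) b) A0 M"
        using gtp_over_range[OF inf M r[OF xy(1)] r[OF xy(2)] cb cb] ran by simp
      have A0M: "A0 \<subseteq> carrier M" using A0 A by blast
      \<comment> \<open>Once the types agree over \<open>A0 = ran b\<close>, the sequence
        \<open>b\<close> has done its work; this reindexing drops it and keeps the element at
        position \<open>None\<close>.\<close>
      have c1: "case_option (Some z) b \<circ>\<^sub>m [0 \<mapsto> None] = [0 \<mapsto> z]" for z
        by (auto simp: map_comp_def)
      show "gtp K [0 \<mapsto> x] A0 M = gtp K [0 \<mapsto> y] A0 M"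
        using gtp_reindex[OF M A0M r[OF xy(1)] M A0M r[OF xy(2)] over, of "[0 \<mapsto> None]"]
        unfolding c1 .
    qed
  qed
  then have f: "|?f ` carrier M| \<le>o exp2 \<theta>" by (rule ordLeq_transitive[OF _ count])
  have inf2: "Cinfinite (exp2 \<theta>)" by (rule Cinfinite_exp2[OF th])
  have "|{gtp K (Map.empty :: nat \<rightharpoonup> 'u) A M} \<union> ?f ` carrier M| \<le>o exp2 \<theta>"
  proof (rule Un_Cinfinite_bound[OF _ f inf2])
    show "|{gtp K (Map.empty :: nat \<rightharpoonup> 'u) A M}| \<le>o exp2 \<theta>"
      using inf2 by (intro Card_order_singl_ordLeq) (auto simp: cinfinite_def)
  qed
  then show ?thesis by (rule ordLeq_transitive[OF card_of_mono1[OF gS_less_in_2_subset]])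
qed

end

section \<open>Bounds on the first stability cardinal\<close>

context AEC
begin

text \<open>Here \<open>JJ\<close> consists of the proper initial segments of
  \<open>\<kappa>\<close>. As \<open>\<kappa>\<close> is infinite, an element with two
  \<open>J\<close>-sequences still has fewer than \<open>\<kappa>\<close> entries and fits a length
  below \<open>\<kappa>\<close>; the summand for the element makes that length nonzero.\<close>

lemma card_of_gS_initial_segments:
  fixes \<theta> :: "'h rel" and \<chi> :: "'c rel" and \<kappa> :: "'k rel" and N :: "'k set \<Rightarrow> 'n set"
  assumes inf: "infinite (UNIV :: 'u set)"
    and kappa: "Cinfinite \<kappa>" "\<kappa> \<le>o \<chi>" and th: "Cinfinite \<theta>" and ch: "Card_order \<chi>" "\<chi> \<le>o \<theta>"
    and types: "\<And>z M. z \<in> Field \<kappa> \<Longrightarrow> M \<in> models K \<Longrightarrow>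
      |(\<lambda>a. gtp K a {} M) ` seqs (insert None (Some ` underS \<kappa> z)) (carrier M)| \<le>o |Pow (N (underS \<kappa> z))|"
    and N: "\<And>z. z \<in> Field \<kappa> \<Longrightarrow> |N (underS \<kappa> z)| \<le>o \<theta>"
    and Pow_N: "\<And>z (B :: 'u set). z \<in> Field \<kappa> \<Longrightarrow> |B| <o \<chi> \<Longrightarrow> |Pow (B \<times> N (underS \<kappa> z))| \<le>o \<theta>"
    and no_order: "\<not> order_property_less K \<kappa> \<chi>" and tame: "tame_less K \<kappa>"
    and M: "M \<in> models K" and A: "A \<subseteq> carrier M" "|A| \<le>o exp2 \<theta>"
  shows "|gS_less_in K (natLeq_on 2) A M| \<le>o exp2 \<theta>"
proof -
  let ?JJ = "underS \<kappa> ` Field \<kappa>"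
  have c: "Card_order \<kappa>" and i: "\<not> finite (Field \<kappa>)" using kappa by (auto simp: cinfinite_def)
  have kt: "\<kappa> \<le>o \<theta>" by (rule ordLeq_transitive[OF kappa(2) ch(2)])
  define \<beta> where "\<beta> J = (SOME \<beta>. \<beta> \<in> ordinals_below \<kappa> \<and> |{()} <+> J <+> J| =o |Field \<beta>| )" for J :: "'k set"
  have b: "\<beta> J \<in> ordinals_below \<kappa> \<and> |{()} <+> J <+> J| =o |Field (\<beta> J)|" if "|J| <o \<kappa>" for J
  proof -
    have "|{()}| <o \<kappa>"
      by (rule Cfinite_ordLess_Cinfinite[OF _ kappa(1)]) (simp add: cfinite_def Field_card_of card_of_card_order_on)
    then have "|{()} <+> J <+> J| <o \<kappa>"
      using that by (intro card_of_Plus_ordLess_infinite_Field i c)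
    then obtain z where "z \<in> Field \<kappa>" and z: "|{()} <+> J <+> J| =o |underS \<kappa> z|"
      "Restr \<kappa> (underS \<kappa> z) \<in> ordinals_below \<kappa>" "Field (Restr \<kappa> (underS \<kappa> z)) = underS \<kappa> z"
      by (rule ex_initial_segment[OF c])
    show ?thesis
      unfolding \<beta>_def
      by (rule someI[of "\<lambda>\<beta>. \<beta> \<in> ordinals_below \<kappa> \<and> |{()} <+> J <+> J| =o |Field \<beta>|"
            "Restr \<kappa> (underS \<kappa> z)"]) (use z in simp)
  qed
  show ?thesis
  proof (rule card_of_gS_if_no_order_property[OF inf th ch _ _ _ _ _ _ _ tame M A,
        where JJ = ?JJ and N = N and \<beta> = \<beta>])
    show "|?JJ| \<le>o \<theta>"
      by (rule ordLeq_transitive[OF card_of_image ordIso_ordLeq_trans[OF card_of_Field_ordIso[OF c] kt]])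
    show "|J| \<le>o \<theta>" if "J \<in> ?JJ" for J
      using that ordLeq_transitive[OF ordLess_imp_ordLeq[OF card_of_underS[OF c]] kt] by blast
    show "\<exists>J \<in> ?JJ. |A0| =o |J| \<or> A0 \<noteq> {} \<and> |A0| \<le>o |J|" if "|A0| <o \<kappa>" for A0 :: "'u set"
      by (rule ex_initial_segment[OF c that]) blast
    show "|{()} <+> J <+> J| \<le>o |Field (\<beta> J)| \<and> \<not> order_property K (\<beta> J) \<chi>" if "J \<in> ?JJ" for J
    proof -
      have "|J| <o \<kappa>" using that card_of_underS[OF c] by blast
      from b[OF this] have bJ: "\<beta> J \<in> ordinals_below \<kappa>" "|{()} <+> J <+> J| =o |Field (\<beta> J)|" by auto
      have "Field (\<beta> J) \<noteq> {}" using bJ(2) card_of_empty2[of "{()} <+> J <+> J"] by auto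
      then show ?thesis
        using bJ no_order ordIso_imp_ordLeq unfolding order_property_less_def by blast
    qed
  qed (use types N Pow_N in auto)
qed

lemma card_of_gtps_in:
  assumes "Cinfinite \<rho>" "|J| \<le>o \<rho>" "LS K \<le>o \<rho>" "M \<in> models K"
  shows "|(\<lambda>a. gtp K a {} M) ` seqs (insert None (Some ` J)) (carrier M)| \<le>o exp2 \<rho>"
proof -
  have "|insert None (Some ` J)| \<le>o \<rho>"
  proof -
    have "|{None} \<union> Some ` J| \<le>o \<rho>"
      using assms(1,2) card_of_image[of Some J] ordLeq_transitive
      by (intro Un_Cinfinite_bound[OF Card_order_singl_ordLeq]) (auto simp: cinfinite_def)
    then show ?thesis by simp
  qed
  from card_of_gtps[OF assms(1) this assms(3)] show ?thesis
    by (rule ordLeq_transitive[OF card_of_mono1, rotated]) (use assms(4) in blast)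
qed

text \<open>The bounds \<open>\<rho>\<close> live on types of iterated power sets, whereas stability
  cardinals live on \<open>'u\<close>. A bound below the size of \<open>'u\<close> has a copy
  there.\<close>

lemma stable_in_transfer:
  assumes bound: "\<And>M A. M \<in> models K \<Longrightarrow> A \<subseteq> carrier M \<Longrightarrow> |A| \<le>o \<rho> \<Longrightarrow>
      |gS_less_in K (natLeq_on 2) A M| \<le>o \<rho>"
    and l: "Card_order \<rho>" "\<rho> <o |UNIV :: 'u set|"
  obtains \<mu> :: "'u rel" where "Card_order \<mu>" "small \<mu>" "\<mu> =o \<rho>" "stable_in K \<mu>"
proof -
  have "|Field \<rho>| \<le>o |UNIV :: 'u set|"
    using l card_of_Field_ordIso ordIso_ordLeq_trans ordLess_imp_ordLeq by blast
  from this[unfolded internalize_card_of_ordLeq[of "Field \<rho>"]]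
  obtain B :: "'u set" where "|Field \<rho>| =o |B|" by (elim exE conjE)
  then have B: "|B| =o \<rho>"
    by (rule ordIso_transitive[OF ordIso_symmetric card_of_Field_ordIso[OF l(1)]])
  have "stable_in K |B|"
    unfolding stable_in_def
  proof (intro ballI allI impI)
    fix M and A :: "'u set" assume MA: "M \<in> models K" "A \<subseteq> carrier M" "|A| \<le>o |B|"
    show "|gS_less_in K (natLeq_on 2) A M| \<le>o |B|"
      by (rule ordLeq_ordIso_trans[OF bound[OF MA(1,2) ordLeq_ordIso_trans[OF MA(3) B]] ordIso_symmetric[OF B]])
  qed
  moreover have "small |B|" unfolding small_def by (rule ordIso_ordLess_trans[OF B l(2)])
  ultimately show thesis using that B card_of_Card_order by blast
qed

lemma first_stability_cardinal_le:
  assumes bound: "\<And>M A. M \<in> models K \<Longrightarrow> A \<subseteq> carrier M \<Longrightarrow> |A| \<le>o \<rho> \<Longrightarrow>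
      |gS_less_in K (natLeq_on 2) A M| \<le>o \<rho>"
    and l: "Card_order \<rho>" "\<rho> <o |UNIV :: 'u set|" "LS K \<le>o \<rho>"
  shows "first_stability_cardinal K \<le>o \<rho>"
proof -
  obtain \<mu> :: "'u rel" where mu: "Card_order \<mu>" "small \<mu>" "\<mu> =o \<rho>" "stable_in K \<mu>"
    by (rule stable_in_transfer[OF bound l(1,2)])
  have "LS K \<le>o \<mu>" by (rule ordLeq_ordIso_trans[OF l(3) ordIso_symmetric[OF mu(3)]])
  then have "first_stability_cardinal K \<le>o \<mu>"
    using least_card[of \<mu> "\<lambda>\<mu>. small \<mu> \<and> LS K \<le>o \<mu> \<and> stable_in K \<mu>"] mu
    unfolding first_stability_cardinal_def by blast
  then show ?thesis by (rule ordLeq_ordIso_trans[OF _ mu(3)])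
qed

lemma first_infinite_stability_cardinal_le:
  assumes bound: "\<And>M A. M \<in> models K \<Longrightarrow> A \<subseteq> carrier M \<Longrightarrow> |A| \<le>o \<rho> \<Longrightarrow>
      |gS_less_in K (natLeq_on 2) A M| \<le>o \<rho>"
    and l: "Card_order \<rho>" "\<rho> <o |UNIV :: 'u set|" "natLeq \<le>o \<rho>"
  shows "first_infinite_stability_cardinal K \<le>o \<rho>"
proof -
  obtain \<mu> :: "'u rel" where mu: "Card_order \<mu>" "small \<mu>" "\<mu> =o \<rho>" "stable_in K \<mu>"
    by (rule stable_in_transfer[OF bound l(1,2)])
  have "natLeq \<le>o \<mu>" by (rule ordLeq_ordIso_trans[OF l(3) ordIso_symmetric[OF mu(3)]])
  then have "first_infinite_stability_cardinal K \<le>o \<mu>"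
    using least_card[of \<mu> "\<lambda>\<mu>. small \<mu> \<and> natLeq \<le>o \<mu> \<and> stable_in K \<mu>"] mu
    unfolding first_infinite_stability_cardinal_def by blast
  then show ?thesis by (rule ordLeq_ordIso_trans[OF _ mu(3)])
qed

section \<open>Types of finite sequences over the empty set\<close>

lemma gal_step_trancl_dom_eq: "((a, A, M), (b, B, N)) \<in> (gal_step K)\<^sup>+ \<Longrightarrow> dom a = dom b"
proof -
  have dom_step: "dom a = dom b" if ab: "((a, A, M), (b, B, N)) \<in> gal_step K"
    for a b :: "'i \<rightharpoonup> 'u" and A B M N
  proof -
    obtain f g :: "'u \<Rightarrow> 'u" where "map_option f \<circ> a = map_option g \<circ> b"
      using ab unfolding gal_step_iff by blast
    then have "dom (map_option f \<circ> a) = dom (map_option g \<circ> b)" by simp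
    then show ?thesis by (simp add: dom_def)
  qed
  have "dom (fst s) = dom (fst t)" if "(s, t) \<in> (gal_step K)\<^sup>+" for s t :: "('i, 'u, 'f, 'r) triple"
    using that
  proof (induction rule: trancl_induct)
    case (base t)
    obtain a A M b B N where "s = (a, A, M)" "t = (b, B, N)" by (cases s, cases t)
    then show ?case using dom_step base by simp
  next
    case (step t u)
    obtain a A M b B N where "t = (a, A, M)" "u = (b, B, N)" by (cases t, cases u)
    then show ?case using dom_step step by simp
  qed
  from this[of "(a, A, M)" "(b, B, N)"] show "((a, A, M), (b, B, N)) \<in> (gal_step K)\<^sup>+ \<Longrightarrow> dom a = dom b"
    by simp
qed

lemma underS_natLeq: "underS natLeq n = {..<n}"
  by (auto simp: underS_def natLeq_def)

lemma gS_less_natLeq: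
  "gS_less K natLeq {} = (\<Union>n. {gtp K a {} M | M a. M \<in> models K \<and> a \<in> seqs {..<n} (carrier M)})"
proof -
  have F: "Field (Restr natLeq {..<n}) = {..<n}" for n
    by (auto simp: Field_def natLeq_def)
  have "ordinals_below natLeq = range (\<lambda>n. Restr natLeq {..<n})"
    unfolding ordinals_below_def Field_natLeq underS_natLeq by auto
  then show ?thesis
    unfolding gS_less_def gS_less_in_def gS_in_def seqs_def by (auto simp: F; blast)
qed

text \<open>Galois types remember the length of a sequence, so constant sequences of different
  finite lengths have different types.\<close>

lemma natLeq_le_card_D: "natLeq \<le>o card_D K"
proof -
  obtain M where M: "M \<in> models K" using nonempty by blast
  then obtain m where m: "m \<in> carrier M" using models_struct[OF M] by (auto simp: is_struct_def)
  define a where "a n = (\<lambda>i. if i < n then Some m else None)" for n :: nat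
  have dom: "dom (a n) = {..<n}" and ran: "ran (a n) \<subseteq> carrier M" for n
    using m by (auto simp: a_def dom_def ran_def split: if_splits)
  have "|UNIV :: nat set| \<le>o |gS_less K natLeq {}|"
  proof (rule card_of_ordLeqI[where f = "\<lambda>n. gtp K (a n) {} M"])
    show "inj (\<lambda>n. gtp K (a n) {} M)"
    proof (rule injI)
      fix n k assume "gtp K (a n) {} M = gtp K (a k) {} M"
      then have "dom (a n) = dom (a k)"
        using gtp_eq_iff[OF M _ ran M _ ran, of "{}" "{}" n k] by (intro gal_step_trancl_dom_eq) auto
      then show "n = k" unfolding dom by simp
    qed
  next
    fix n show "gtp K (a n) {} M \<in> gS_less K natLeq {}"
      unfolding gS_less_natLeq seqs_def using M dom ran by blast
  qed
  then show ?thesis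
    unfolding card_D_def by (rule ordIso_ordLeq_trans[OF ordIso_symmetric[OF card_of_nat]])
qed

text \<open>Its purpose is smallness: it puts \<open>card_D K\<close> below the inaccessible size of
  \<open>'u\<close>.\<close>

lemma card_D_le: "card_D K \<le>o exp2 (LS K)"
  unfolding card_D_def gS_less_natLeq
proof (rule UNION_Cinfinite_bound[OF _ _ Cinfinite_exp2[OF Cinfinite_LS]])
  have L: "natLeq \<le>o LS K" by (rule natLeq_ordLeq_cinfinite[OF Cinfinite_LS])
  have nat: "|UNIV :: nat set| \<le>o LS K" by (rule ordIso_ordLeq_trans[OF card_of_nat L])
  then show "|UNIV :: nat set| \<le>o exp2 (LS K)"
    by (rule ordLeq_transitive[OF _ ordLeq_exp2]) (simp add: Cinfinite_LS)
  show "\<forall>n \<in> UNIV. |{gtp K a {} M | M a. M \<in> models K \<and> a \<in> seqs {..<n :: nat} (carrier M)}| \<le>o exp2 (LS K)"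
  proof
    fix n :: nat
    show "|{gtp K a {} M | M a. M \<in> models K \<and> a \<in> seqs {..<n} (carrier M)}| \<le>o exp2 (LS K)"
      using Cinfinite_LS by (intro card_of_gtps ordLeq_transitive[OF card_of_mono1 nat] ordLeq_refl) auto
  qed
qed

text \<open>An element followed by an \<open>n\<close>-sequence is a sequence of length
  \<open>n + 1\<close> up to renaming positions, and since the renaming can be undone, no two types
  are merged.\<close>

lemma card_of_gtps_le_card_D:
  assumes M: "M \<in> models K"
  shows "|(\<lambda>a. gtp K a {} M) ` seqs (insert None (Some ` {..<n :: nat})) (carrier M)| \<le>o card_D K"
proof -
  \<comment> \<open>Position \<open>0\<close> holds the element, position \<open>i + 1\<close> the
    entry \<open>i\<close> of the sequence; \<open>r'\<close> is the inverse renaming.\<close>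
  define r where "r k = (if k = 0 then Some None else if k \<le> n then Some (Some (k - 1)) else None)" for k :: nat
  define r' where "r' j = (case j of None \<Rightarrow> Some 0 | Some i \<Rightarrow> if i < n then Some (Suc i) else None)" for j
  let ?S = "seqs (insert None (Some ` {..<n})) (carrier M)"
  have undo: "(a \<circ>\<^sub>m r) \<circ>\<^sub>m r' = a" if a: "a \<in> ?S" for a
  proof
    fix j
    have "a (Some i) = None" if "\<not> i < n" for i
      using a that by (auto simp: seqs_def)
    then show "((a \<circ>\<^sub>m r) \<circ>\<^sub>m r') j = a j"
      by (cases j) (auto simp: map_comp_def r_def r'_def)
  qed
  have mem: "a \<circ>\<^sub>m r \<in> seqs {..<Suc n} (carrier M)" if a: "a \<in> ?S" for a
  proof -
    have d: "j \<in> dom a \<longleftrightarrow> j \<in> insert None (Some ` {..<n})" for j using a by (simp add: seqs_def)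
    have "k \<in> dom (a \<circ>\<^sub>m r) \<longleftrightarrow> k \<in> {..<Suc n}" for k
      using d[of None] d[of "Some (k - 1)"] by (auto simp: map_comp_def r_def dom_def)
    moreover have "ran (a \<circ>\<^sub>m r) \<subseteq> carrier M"
      using a by (intro subset_trans[OF ran_map_comp]) (simp add: seqs_def)
    ultimately show ?thesis unfolding seqs_def by blast
  qed
  have "|(\<lambda>a. gtp K a {} M) ` ?S| \<le>o |(\<lambda>a. gtp K (a \<circ>\<^sub>m r) {} M) ` ?S|"
  proof (rule card_of_image_kernel)
    fix a b assume ab: "a \<in> ?S" "b \<in> ?S" and eq: "gtp K (a \<circ>\<^sub>m r) {} M = gtp K (b \<circ>\<^sub>m r) {} M"
    have "ran (a \<circ>\<^sub>m r) \<subseteq> carrier M" "ran (b \<circ>\<^sub>m r) \<subseteq> carrier M"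
      using mem[OF ab(1)] mem[OF ab(2)] by (auto simp: seqs_def)
    from gtp_reindex[OF M _ this(1) M _ this(2) eq, of r'] show "gtp K a {} M = gtp K b {} M"
      unfolding undo[OF ab(1)] undo[OF ab(2)] by simp
  qed
  also have "|(\<lambda>a. gtp K (a \<circ>\<^sub>m r) {} M) ` ?S| \<le>o card_D K"
    unfolding card_D_def gS_less_natLeq by (rule card_of_mono1) (use mem M in blast)
  finally show ?thesis .
qed

end

text \<open>Strong inaccessibility is stated for cardinals on \<open>'u\<close> only; a smaller
  cardinal on any other type is first copied to \<open>'u\<close>.\<close>

lemma exp2_ordLess_strongly_inaccessible:
  fixes \<rho> :: "'a rel"
  assumes inacc: "strongly_inaccessible |UNIV :: 'u set|" and r: "Card_order \<rho>" "\<rho> <o |UNIV :: 'u set|"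
  shows "exp2 \<rho> <o |UNIV :: 'u set|"
proof -
  have "|Field \<rho>| <o |UNIV :: 'u set|" by (rule ordLess_Field[OF r(2)])
  from this[unfolded internalize_card_of_ordLess[of "Field \<rho>"]]
  obtain B :: "'u set" where B: "|Field \<rho>| =o |B|" "|B| <o |UNIV :: 'u set|" by (elim exE conjE)
  have "exp2 \<rho> =o exp2 |B|"
    using r(1) B(1) card_of_Field_ordIso ordIso_transitive ordIso_symmetric
    by (intro cexp_cong2 Card_order_ctwo) blast+
  moreover have "exp2 |B| <o |UNIV :: 'u set|"
    using inacc B(2) card_of_Card_order unfolding strongly_inaccessible_def by blast
  ultimately show ?thesis by (rule ordIso_ordLess_trans)
qed

lemma infinite_UNIV_if_strongly_inaccessible:
  assumes "strongly_inaccessible |UNIV :: 'u set|"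
  shows "infinite (UNIV :: 'u set)"
proof -
  have "natLeq <o |UNIV :: 'u set|" using assms unfolding strongly_inaccessible_def by (elim conjE)
  from ordLess_imp_ordLeq[OF this] show ?thesis
    using infinite_iff_natLeq_ordLeq[of "UNIV :: 'u set"] by blast
qed

context AEC
begin

lemma LS_small: "LS K <o |UNIV :: 'u set|"
  using LS_is_LS_bound unfolding is_LS_bound_def small_def by (elim conjE)

text \<open>Taking \<open>\<theta> = 2^{<\<chi>}\<close> works because the exponents
  \<open>N J\<close> stay strictly below \<open>\<chi>\<close>: for \<open>B\<close> below
  \<open>\<chi>\<close> the product of \<open>B\<close> and \<open>N J\<close> is then below
  \<open>\<chi>\<close> too, and its power set is bounded by \<open>\<theta>\<close>.\<close>

lemma first_stability_cardinal_le_if_tame_less: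
  fixes \<kappa> :: "'k rel"
  defines "\<chi> \<equiv> exp2_less (\<kappa> +c cardSuc (LS K))"
  assumes inacc: "strongly_inaccessible |UNIV :: 'u set|"
    and kappa: "Card_order \<kappa>" "cinfinite \<kappa>" "\<kappa> <o |UNIV :: 'u set|"
    and tame: "tame_less K \<kappa>" and no_order: "\<not> order_property_less K \<kappa> \<chi>"
  shows "first_stability_cardinal K \<le>o exp2 (exp2_less \<chi>)"
proof -
  let ?k = "\<kappa> +c cardSuc (LS K)" and ?\<theta> = "exp2_less \<chi>"
  have LS: "Cinfinite (LS K)" "Card_order (LS K)" using Cinfinite_LS by auto
  have cs: "Card_order (cardSuc (LS K))" by (rule cardSuc_Card_order[OF LS(2)])
  have k: "Cinfinite ?k" using kappa by (intro Cinfinite_csum1) simp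
  have kc: "Card_order ?k" "\<not> finite (Field ?k)" using k by (auto simp: cinfinite_def)
  have k\<chi>: "?k \<le>o \<chi>" unfolding \<chi>_def by (rule ordLeq_exp2_less[OF kc(1)])
  have \<chi>: "Cinfinite \<chi>"
    using cinfinite_mono[OF k\<chi>] k unfolding \<chi>_def by (simp add: exp2_less(1))
  have \<chi>\<theta>: "\<chi> \<le>o ?\<theta>" using \<chi> by (intro ordLeq_exp2_less) simp
  have \<theta>: "Cinfinite ?\<theta>"
    using cinfinite_mono[OF \<chi>\<theta>] \<chi> by (simp add: exp2_less(1))
  have \<kappa>k: "\<kappa> \<le>o ?k" by (rule ordLeq_csum1[OF kappa(1)])
  have LSk: "LS K <o ?k"
    by (rule ordLess_ordLeq_trans[OF cardSuc_greater[OF LS(2)] ordLeq_csum2[OF cs]])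
  \<comment> \<open>The summand \<open>Field (LS K)\<close> makes the exponent infinite and large
    enough for the Loewenheim-Skolem count. The summand \<open>LS(K)^+\<close> in
    \<open>\<kappa> + LS(K)^+\<close> is what keeps it strictly below that cardinal.\<close>
  define N where "N J = J <+> Field (LS K)" for J :: "'k set"
  have N: "|N (underS \<kappa> z)| <o ?k" if z: "z \<in> Field \<kappa>" for z
    unfolding N_def
    by (rule card_of_Plus_ordLess_infinite_Field[OF kc(2,1)
          ordLess_ordLeq_trans[OF card_of_underS[OF kappa(1) z] \<kappa>k] ordLess_Field[OF LSk]])
  have N\<chi>: "|N (underS \<kappa> z)| <o \<chi>" if z: "z \<in> Field \<kappa>" for z
    by (rule ordLess_ordLeq_trans[OF N[OF z] k\<chi>])
  have infN: "infinite (N J)" for J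
    using LS(1) unfolding N_def cinfinite_def by simp
  have LSN: "LS K \<le>o |N J|" for J
    unfolding N_def using card_of_Plus2 Card_order_Plus2[OF LS(2)] by blast
  have bound: "|gS_less_in K (natLeq_on 2) A M| \<le>o exp2 ?\<theta>"
    if MA: "M \<in> models K" "A \<subseteq> carrier M" "|A| \<le>o exp2 ?\<theta>" for M A
  proof (rule card_of_gS_initial_segments[OF _ _ _ \<theta> _ \<chi>\<theta> _ _ _ no_order tame MA, where N = N])
    show "infinite (UNIV :: 'u set)"
      by (rule infinite_UNIV_if_strongly_inaccessible[OF inacc])
    show "Cinfinite \<kappa>" using kappa by simp
    show "\<kappa> \<le>o \<chi>" by (rule ordLeq_transitive[OF \<kappa>k k\<chi>])
    show "Card_order \<chi>" using \<chi> by simp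
  next
    fix z M assume z: "z \<in> Field \<kappa>" and M: "M \<in> models K"
    let ?J = "underS \<kappa> z"
    have "|(\<lambda>a. gtp K a {} M) ` seqs (insert None (Some ` ?J)) (carrier M)| \<le>o exp2 |N ?J|"
    proof (rule card_of_gtps_in[OF _ _ LSN M])
      show "Cinfinite |N ?J|" using infN by (simp add: cinfinite_def Field_card_of card_of_card_order_on)
      show "|?J| \<le>o |N ?J|" unfolding N_def by (rule card_of_Plus1)
    qed
    then show "|(\<lambda>a. gtp K a {} M) ` seqs (insert None (Some ` ?J)) (carrier M)| \<le>o |Pow (N ?J)|"
      by (rule ordLeq_ordIso_trans[OF _ ordIso_symmetric[OF card_of_Pow_exp2]])
  next
    fix z assume z: "z \<in> Field \<kappa>"
    show "|N (underS \<kappa> z)| \<le>o ?\<theta>"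
      by (rule ordLeq_transitive[OF ordLess_imp_ordLeq[OF N\<chi>[OF z]] \<chi>\<theta>])
  next
    fix z and B :: "'u set" assume z: "z \<in> Field \<kappa>" and B: "|B| <o \<chi>"
    show "|Pow (B \<times> N (underS \<kappa> z))| \<le>o ?\<theta>"
      by (rule Pow_le_exp2_less[OF card_of_Times_ordLess[OF \<chi> B N\<chi>[OF z] infN]])
  qed
  have inf: "infinite (UNIV :: 'u set)"
    by (rule infinite_UNIV_if_strongly_inaccessible[OF inacc])
  have cs_small: "cardSuc (LS K) <o |UNIV :: 'u set|"
  proof (rule ordLeq_ordLess_trans[OF cardSuc_least])
    show "LS K <o exp2 (LS K)" by (rule ordLess_ctwo_cexp[OF LS(2)])
    show "exp2 (LS K) <o |UNIV :: 'u set|"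
      by (rule exp2_ordLess_strongly_inaccessible[OF inacc LS(2) LS_small])
  qed (simp_all add: LS Card_order_cexp)
  have k_small: "?k <o |UNIV :: 'u set|"
    unfolding csum_def
    by (rule card_of_Plus_ordLess_infinite[OF inf ordLess_Field[OF kappa(3)] ordLess_Field[OF cs_small]])
  have \<chi>_small: "\<chi> <o |UNIV :: 'u set|"
    unfolding \<chi>_def
    by (rule ordLeq_ordLess_trans[OF exp2_less_le_exp2[OF kc(1)]
          exp2_ordLess_strongly_inaccessible[OF inacc kc(1) k_small]])
  have \<chi>c: "Card_order \<chi>" using \<chi> by simp
  have \<theta>_small: "?\<theta> <o |UNIV :: 'u set|"
    by (rule ordLeq_ordLess_trans[OF exp2_less_le_exp2[OF \<chi>c]
          exp2_ordLess_strongly_inaccessible[OF inacc \<chi>c \<chi>_small]])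
  show ?thesis
  proof (rule first_stability_cardinal_le[OF bound Card_order_cexp])
    show "exp2 ?\<theta> <o |UNIV :: 'u set|"
      by (rule exp2_ordLess_strongly_inaccessible[OF inacc exp2_less(1) \<theta>_small])
    show "LS K \<le>o exp2 ?\<theta>"
      by (rule ordLeq_transitive[OF ordLess_imp_ordLeq[OF LSk]
            ordLeq_transitive[OF k\<chi> ordLeq_transitive[OF \<chi>\<theta> ordLeq_exp2[OF exp2_less(1)]]]])
  qed
qed

text \<open>Every nonempty parameter set of size at most \<open>LS K\<close> is enumerated by
  \<open>Field (LS K)\<close>, and the empty one by \<open>{}\<close>, so two index sets suffice and
  both fit the single length \<open>LS K\<close>. A set \<open>B\<close> below
  \<open>2^LS(K)\<close> has a product with \<open>LS K\<close> of size at most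
  \<open>2^LS(K)\<close>, whence \<open>\<theta>\<close> is \<open>beth2 (LS K)\<close>.\<close>

lemma first_stability_cardinal_le_if_tame_LS:
  assumes inacc: "strongly_inaccessible |UNIV :: 'u set|"
    and tame: "tame K (LS K)" and no_order: "\<not> order_property K (LS K) (exp2 (LS K))"
  shows "first_stability_cardinal K \<le>o beth3 (LS K)"
proof -
  let ?\<chi> = "exp2 (LS K)" and ?\<theta> = "beth2 (LS K)" and ?JJ = "{{}, Field (LS K)}"
  have LS: "Cinfinite (LS K)" "Card_order (LS K)" "\<not> finite (Field (LS K))"
    using Cinfinite_LS by (auto simp: cinfinite_def)
  have inf: "infinite (UNIV :: 'u set)"
    by (rule infinite_UNIV_if_strongly_inaccessible[OF inacc])
  have \<chi>: "Cinfinite ?\<chi>" "Card_order ?\<chi>" "\<not> finite (Field ?\<chi>)"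
    using Cinfinite_exp2[OF LS(1)] by (auto simp: cinfinite_def)
  have \<theta>: "Cinfinite ?\<theta>" by (rule Cinfinite_exp2[OF \<chi>(1)])
  have \<chi>\<theta>: "?\<chi> \<le>o ?\<theta>" by (rule ordLeq_exp2[OF \<chi>(2)])
  have LS\<chi>: "LS K \<le>o ?\<chi>" by (rule ordLeq_exp2[OF LS(2)])
  have LS\<theta>: "LS K \<le>o ?\<theta>" by (rule ordLeq_transitive[OF LS\<chi> \<chi>\<theta>])
  have F: "|Field (LS K)| \<le>o LS K" by (rule ordIso_imp_ordLeq[OF card_of_Field_ordIso[OF LS(2)]])
  have J: "|J| \<le>o LS K" if "J \<in> ?JJ" for J
    using that F ordLeq_transitive[OF card_of_empty F] by blast
  have bound: "|gS_less_in K (natLeq_on 2) A M| \<le>o exp2 ?\<theta>"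
    if MA: "M \<in> models K" "A \<subseteq> carrier M" "|A| \<le>o exp2 ?\<theta>" for M A
  proof (rule card_of_gS_if_no_order_property[OF inf \<theta> \<chi>(2) \<chi>\<theta> _ _ _ _ _ _ _
        tame[unfolded tame_def] MA, where JJ = ?JJ and N = "\<lambda>_. Field (LS K)" and \<beta> = "\<lambda>_. LS K"])
    show "|?JJ| \<le>o ?\<theta>"
      by (rule ordLess_imp_ordLeq[OF Cfinite_ordLess_Cinfinite[OF _ \<theta>]])
        (simp add: cfinite_def Field_card_of card_of_card_order_on)
    show "|J| \<le>o ?\<theta>" if "J \<in> ?JJ" for J by (rule ordLeq_transitive[OF J[OF that] LS\<theta>])
    show "|(\<lambda>a. gtp K a {} M) ` seqs (insert None (Some ` J)) (carrier M)| \<le>o |Pow (Field (LS K))|"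
      if "J \<in> ?JJ" "M \<in> models K" for J M
    proof -
      have "exp2 (LS K) =o |Pow (Field (LS K))|"
        using cexp_cong2[OF card_of_Field_ordIso[OF LS(2)] Card_order_ctwo card_of_Card_order]
          card_of_Pow_exp2 ordIso_symmetric ordIso_transitive by blast
      then show ?thesis
        by (rule ordLeq_ordIso_trans[OF card_of_gtps_in[OF LS(1) J[OF that(1)] ordLeq_refl[OF LS(2)] that(2)]])
    qed
    show "|Field (LS K)| \<le>o ?\<theta>" by (rule ordLeq_transitive[OF F LS\<theta>])
    show "|Pow (B \<times> Field (LS K))| \<le>o ?\<theta>" if "|B| <o ?\<chi>" for B :: "'u set"
      by (rule card_of_Pow_le_exp2[OF card_of_Times_ordLeq_infinite_Field[OF \<chi>(3)
            ordLess_imp_ordLeq[OF that] ordLeq_transitive[OF F LS\<chi>] \<chi>(2)]])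
    show "\<exists>J \<in> ?JJ. |A0| =o |J| \<or> A0 \<noteq> {} \<and> |A0| \<le>o |J|" if "|A0| <o cardSuc (LS K)" for A0 :: "'u set"
    proof (cases "A0 = {}")
      case True
      then show ?thesis using card_of_empty_ordIso by blast
    next
      case False
      have "|A0| \<le>o LS K" using that cardSuc_ordLeq_ordLess[OF LS(2) card_of_Card_order] by blast
      then have "|A0| \<le>o |Field (LS K)|"
        by (rule ordLeq_ordIso_trans[OF _ ordIso_symmetric[OF card_of_Field_ordIso[OF LS(2)]]])
      then show ?thesis using False by blast
    qed
    show "|{()} <+> J <+> J| \<le>o |Field (LS K)| \<and> \<not> order_property K (LS K) ?\<chi>" if "J \<in> ?JJ" for J
    proof -
      have "|{()}| \<le>o LS K" using LS by (intro Card_order_singl_ordLeq) auto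
      then have "|{()} <+> J <+> J| \<le>o LS K"
        using J[OF that] by (intro card_of_Plus_ordLeq_infinite_Field LS)
      then have "|{()} <+> J <+> J| \<le>o |Field (LS K)|"
        by (rule ordLeq_ordIso_trans[OF _ ordIso_symmetric[OF card_of_Field_ordIso[OF LS(2)]]])
      then show ?thesis using no_order by simp
    qed
  qed
  show ?thesis
  proof (rule first_stability_cardinal_le[OF bound Card_order_cexp])
    show "exp2 ?\<theta> <o |UNIV :: 'u set|"
      by (intro exp2_ordLess_strongly_inaccessible[OF inacc] Card_order_cexp LS(2) LS_small)
    show "LS K \<le>o exp2 ?\<theta>"
      by (rule ordLeq_transitive[OF LS\<theta> ordLeq_exp2[OF Card_order_cexp]])
  qed
qed

text \<open>All index sets are finite, so the types involved are counted by \<open>card_D K\<close>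
  directly and \<open>LS K\<close> does not enter the bound. The exponent is \<open>card_D K\<close>
  itself, through the crude estimate of \<open>card_D K\<close> by its power set, and
  \<open>\<theta>\<close> is \<open>2^card_D\<close>.\<close>

lemma first_infinite_stability_cardinal_le_if_tame_natLeq:
  assumes inacc: "strongly_inaccessible |UNIV :: 'u set|"
    and tame: "tame_less K natLeq" and no_order: "\<not> order_property_less K natLeq (card_D K)"
  shows "first_infinite_stability_cardinal K \<le>o beth2 (card_D K)"
proof -
  let ?\<chi> = "card_D K" and ?\<theta> = "exp2 (card_D K)"
  have inf: "infinite (UNIV :: 'u set)"
    by (rule infinite_UNIV_if_strongly_inaccessible[OF inacc])
  have c: "Card_order ?\<chi>" unfolding card_D_def by (rule card_of_Card_order)
  have \<chi>: "Cinfinite ?\<chi>" using cinfinite_mono[OF natLeq_le_card_D natLeq_cinfinite] c by simp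
  then have \<chi>_inf: "\<not> finite (Field ?\<chi>)" by (simp add: cinfinite_def)
  have \<theta>: "Cinfinite ?\<theta>" by (rule Cinfinite_exp2[OF \<chi>])
  have \<chi>\<theta>: "?\<chi> \<le>o ?\<theta>" by (rule ordLeq_exp2[OF c])
  have F: "|Field ?\<chi>| \<le>o ?\<chi>" by (rule ordIso_imp_ordLeq[OF card_of_Field_ordIso[OF c]])
  have bound: "|gS_less_in K (natLeq_on 2) A M| \<le>o exp2 ?\<theta>"
    if MA: "M \<in> models K" "A \<subseteq> carrier M" "|A| \<le>o exp2 ?\<theta>" for M A
  proof (rule card_of_gS_initial_segments[OF inf natLeq_Cinfinite natLeq_le_card_D \<theta> c \<chi>\<theta> _ _ _
        no_order tame MA, where N = "\<lambda>_. Field ?\<chi>"])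
    show "|(\<lambda>a. gtp K a {} M) ` seqs (insert None (Some ` underS natLeq n)) (carrier M)|
        \<le>o |Pow (Field ?\<chi>)|" if "M \<in> models K" for n M
      unfolding underS_natLeq
      by (rule ordLeq_transitive[OF card_of_gtps_le_card_D[OF that] ordLess_imp_ordLeq[OF Card_order_Pow[OF c]]])
    show "|Field ?\<chi>| \<le>o ?\<theta>" by (rule ordLeq_transitive[OF F \<chi>\<theta>])
    show "|Pow (B \<times> Field ?\<chi>)| \<le>o ?\<theta>" if "|B| <o ?\<chi>" for B :: "'u set"
      by (rule card_of_Pow_le_exp2[OF card_of_Times_ordLeq_infinite_Field[OF \<chi>_inf
            ordLess_imp_ordLeq[OF that] F c]])
  qed
  have "?\<chi> <o |UNIV :: 'u set|"
    by (rule ordLeq_ordLess_trans[OF card_D_le exp2_ordLess_strongly_inaccessible[OF inacc _ LS_small]])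
      (simp add: Cinfinite_LS)
  then have small: "exp2 ?\<theta> <o |UNIV :: 'u set|"
    by (intro exp2_ordLess_strongly_inaccessible[OF inacc] Card_order_cexp c)
  have "natLeq \<le>o exp2 ?\<theta>" by (rule natLeq_ordLeq_cinfinite[OF Cinfinite_exp2[OF \<theta>]])
  from first_infinite_stability_cardinal_le[OF _ Card_order_cexp small this] bound
  show ?thesis by blast
qed

end

theorem corollary6p6:
  fixes K :: "('u, 'f, 'r) abstract_class"
  assumes "strongly_inaccessible |UNIV :: 'u set|"
    and "AEC K"
    and "stable_class K"
  shows
    "(\<forall>\<kappa> :: 'u rel. let \<chi> = exp2_less (\<kappa> +c cardSuc (LS K)) in
        Card_order \<kappa> \<and> cinfinite \<kappa> \<and> small \<kappa> \<and> tame_less K \<kappa> \<and> \<not> order_property_less K \<kappa> \<chi> \<longrightarrow>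
          first_stability_cardinal K \<le>o exp2 (exp2_less \<chi>)) \<and>
     (tame K (LS K) \<and> \<not> order_property K (LS K) (exp2 (LS K)) \<longrightarrow>
          first_stability_cardinal K \<le>o beth3 (LS K)) \<and>
     (tame_less K natLeq \<and> \<not> order_property_less K natLeq (card_D K) \<longrightarrow>
          first_infinite_stability_cardinal K \<le>o beth2 (card_D K))"
proof -
  interpret AEC K by (rule assms(2))
  show ?thesis
    unfolding Let_def small_def
    using first_stability_cardinal_le_if_tame_less[OF assms(1)]
      first_stability_cardinal_le_if_tame_LS[OF assms(1)]
      first_infinite_stability_cardinal_le_if_tame_natLeq[OF assms(1)]
    by (intro conjI allI impI) (elim conjE, assumption?)+
qed

end
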